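(* Let $t\ge2$, $n\ge1$, $\omega$ a primitive $t$-th root of unity, $X=(x_1,\dots,x_n)$, $X^t=(x_1^t,\dots,x_n^t)$, $\overline{X}^t=(x_1^{-t},\dots,x_n^{-t})$. Let $\lambda$ be a partition with $\ell(\lambda)\le tn$, with $n_i=n_i(\lambda,tn)$ and $t$-quotient $(\lambda^{(0)},\dots,\lambda^{(t-1)})$ computed with $m=tn$. Consider the odd orthogonal character $\mathrm{so}_\lambda$ in the $tn$ variables $(X,\omega X,\dots,\omega^{t-1}X)$. (1) If the $t$-core of $\lambda$ is not self-conjugate, then $\mathrm{so}_\lambda(X,\omega X,\dots,\omega^{t-1}X)=0$. (2) If the $t$-core of $\lambda$ is self-conjugate of rank $r$, then \[ \mathrm{so}_\lambda(X,\omega X,\dots,\omega^{t-1}X)=(-1)^{\epsilon}\operatorname{sgn}(\sigma_\lambda)\prod_{i=0}^{\lfloor (t-2)/2\rfloor} s_{\mu^{(3)}_i}(X^t,\overline{X}^t)\times\begin{cases}\mathrm{so}_{\lambda^{((t-1)/2)}}(X^t)& t\text{ odd},\\ 1 & t\text{ even},\end{cases} \] where $\epsilon=-\sum_{i=\lfloor t/2\rfloor}^{t-1}\binom{n_i+1}{2}+\begin{cases}nr & t\text{ odd},\\ 0& t\text{ even},\end{cases}$ and, for $0\le i\le\lfloor(t-2)/2\rfloor$, $\mu^{(3)}_i$ is the sequence of length $2n$ whose $j$-th entry is $\lambda^{(t-1-i)}_1+\lambda^{(i)}_j$ for $1\le j\le n_i$ and $\lambda^{(t-1-i)}_1-\lambda^{(t-1-i)}_{2n+1-j}$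 for $n_i<j\le 2n$ (i.e. $\lambda^{(t-1-i)}_1+(\lambda^{(i)},-\mathrm{rev}(\lambda^{(t-1-i)}))$).
   Context: Beta sets and $t$-quotients: for $\ell(\lambda)\le m$, $\beta(\lambda,m)=(\lambda_j+m-j)_{j=1}^m$; $n_i(\lambda,m)$ is the number of entries congruent to $i$ mod $t$; writing those entries in decreasing order as $t\tilde\beta^{(i)}_j+i$ ($1\le j\le n_i$), $\lambda^{(i)}$ is the partition with $n_i$ parts (possibly zero) $\lambda^{(i)}_j=\tilde\beta^{(i)}_j-n_i+j$. The $t$-core is obtained by successively removing border strips of size $t$; a partition is self-conjugate if it equals its conjugate; the rank of a partition $\rho$ is the largest $k$ with $\rho_k\ge k$. $\sigma_\lambda\in S_{tn}$ is the permutation such that $(\beta_{\sigma_\lambda(1)},\dots,\beta_{\sigma_\lambda(tn)})$ (with $\beta=\beta(\lambda,tn)$) lists the entries congruent to $0$ mod $t$ in decreasing order, then those congruent to $1$, ..., then those congruent to $t-1$. Characters in $N$ variables $y$, for weakly decreasing integer sequences $\mu$ of length $N$: $s_\mu(y)=\det(y_i^{\mu_j+N-j})/\det(y_i^{N-j})$; $\mathrm{so}_\mu(y)=\det(y_i^{\mu_j+N-j+1}-y_i^{-(\mu_j+N-j)})/\det(y_i^{N-j+1}-y_i^{-(N-j)})$. $\mathrm{so}_{\lambda^{((t-1)/2)}}$ is in $n$ variables and $s_{\mu^{(3)}_i}$ in $2n$ variables.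
   Formalization: In ε the sum runs from i=⌈t/2⌉ instead of ⌊t/2⌋ (same for even t); for odd t the printed sign is wrong, e.g. t=3, n=1, λ=∅ gives −1 instead of so_∅=1. The x_i are nonzero with all x_i^t, x_i^{-t} distinct, so the quotients are defined. *)

theory Defs
  imports
    "Jordan_Normal_Form.Determinant"
    "HOL-Combinatorics.List_Permutation"
begin

section \<open>Partitions\<close>

definition is_partition :: "nat list \<Rightarrow> bool" where
  "is_partition lam \<longleftrightarrow> sorted_wrt (\<ge>) lam \<and> 0 \<notin> set lam"

text \<open>Parts are numbered from 1, and all parts beyond the length are 0.\<close>

definition part :: "nat list \<Rightarrow> nat \<Rightarrow> nat" where
  "part lam j = (if 1 \<le> j \<and> j \<le> length lam then lam ! (j - 1) else 0)"

definition conjugate :: "nat list \<Rightarrow> nat list" where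
  "conjugate lam = map (\<lambda>j. card {i \<in> {1..length lam}. j \<le> part lam i}) [1..<Suc (part lam 1)]"

definition self_conjugate :: "nat list \<Rightarrow> bool" where
  "self_conjugate lam \<longleftrightarrow> conjugate lam = lam"

text \<open>Since \<^term>\<open>part lam 0 = 0\<close>, the value is 0 for the empty partition.\<close>

definition partition_rank :: "nat list \<Rightarrow> nat" where
  "partition_rank lam = (GREATEST k. k \<le> part lam k)"


section \<open>Border strips and cores\<close>

definition diagram :: "nat list \<Rightarrow> (nat \<times> nat) set" where
  "diagram lam = {(i, j). 1 \<le> i \<and> i \<le> length lam \<and> 1 \<le> j \<and> j \<le> part lam i}"

definition adjacent :: "nat \<times> nat \<Rightarrow> nat \<times> nat \<Rightarrow> bool" where
  "adjacent c d \<longleftrightarrow>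
     \<bar>int (fst c) - int (fst d)\<bar> + \<bar>int (snd c) - int (snd d)\<bar> = 1"

definition cells_connected :: "(nat \<times> nat) set \<Rightarrow> bool" where
  "cells_connected S \<longleftrightarrow>
     (\<forall>c\<in>S. \<forall>d\<in>S. (c, d) \<in> {(a, b). a \<in> S \<and> b \<in> S \<and> adjacent a b}\<^sup>*)"

definition has_square :: "(nat \<times> nat) set \<Rightarrow> bool" where
  "has_square S \<longleftrightarrow> (\<exists>i j. {(i, j), (Suc i, j), (i, Suc j), (Suc i, Suc j)} \<subseteq> S)"

definition removes_border_strip :: "nat \<Rightarrow> nat list \<Rightarrow> nat list \<Rightarrow> bool" where
  "removes_border_strip t lam mu \<longleftrightarrow>
     is_partition lam \<and> is_partition mu \<and> diagram mu \<subseteq> diagram lam \<and>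
     card (diagram lam - diagram mu) = t \<and>
     cells_connected (diagram lam - diagram mu) \<and> \<not> has_square (diagram lam - diagram mu)"

definition is_core_of :: "nat \<Rightarrow> nat list \<Rightarrow> nat list \<Rightarrow> bool" where
  "is_core_of t rho lam \<longleftrightarrow>
     (removes_border_strip t)\<^sup>*\<^sup>* lam rho \<and> (\<nexists>mu. removes_border_strip t rho mu)"

lemma finite_diagram: "finite (diagram lam)"
proof -
  have "diagram lam \<subseteq> (SIGMA i:{1..length lam}. {1..part lam i})"
    by (auto simp: diagram_def)
  then show ?thesis
    by (rule finite_subset) auto
qed

lemma is_core_of_exists:
  assumes "t \<ge> 1"
  shows "\<exists>rho. is_core_of t rho lam"
proof (induction "card (diagram lam)" arbitrary: lam rule: less_induct)
  case less
  show ?case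
  proof (cases "\<exists>mu. removes_border_strip t lam mu")
    case False
    then show ?thesis
      by (auto simp: is_core_of_def)
  next
    case True
    then obtain mu where mu: "removes_border_strip t lam mu"
      by blast
    then have "diagram mu \<subseteq> diagram lam" "diagram lam - diagram mu \<noteq> {}"
      using assms by (auto simp: removes_border_strip_def)
    then have "card (diagram mu) < card (diagram lam)"
      by (intro psubset_card_mono finite_diagram) auto
    then obtain rho where "is_core_of t rho mu"
      using less by blast
    with mu show ?thesis
      unfolding is_core_of_def by (meson converse_rtranclp_into_rtranclp)
  qed
qed


section \<open>Beta sets and quotients\<close>

text \<open>
  For \<^term>\<open>length lam \<le> m\<close> the list below is strictly decreasing, so filtering it keeps the
  entries in decreasing order. In \<open>beta\<close> and \<open>t_quotient\<close> the additions are performed before the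
  subtractions, so that no truncation occurs.
\<close>

definition beta :: "nat list \<Rightarrow> nat \<Rightarrow> nat list" where
  "beta lam m = map (\<lambda>j. part lam j + m - j) [1..<Suc m]"

definition beta_residue :: "nat \<Rightarrow> nat list \<Rightarrow> nat \<Rightarrow> nat \<Rightarrow> nat list" where
  "beta_residue t lam m i = filter (\<lambda>b. b mod t = i) (beta lam m)"

definition n_residue :: "nat \<Rightarrow> nat list \<Rightarrow> nat \<Rightarrow> nat \<Rightarrow> nat" where
  "n_residue t lam m i = length (beta_residue t lam m i)"

text \<open>The component has \<^term>\<open>n_residue t lam m i\<close> entries, trailing zeros included.\<close>

definition t_quotient :: "nat \<Rightarrow> nat list \<Rightarrow> nat \<Rightarrow> nat \<Rightarrow> nat list" where
  "t_quotient t lam m i =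
     map (\<lambda>j. beta_residue t lam m i ! (j - 1) div t + j - n_residue t lam m i)
       [1..<Suc (n_residue t lam m i)]"

definition is_residue_sorting :: "nat \<Rightarrow> nat list \<Rightarrow> nat \<Rightarrow> (nat \<Rightarrow> nat) \<Rightarrow> bool" where
  "is_residue_sorting t lam m \<sigma> \<longleftrightarrow>
     \<sigma> permutes {1..m} \<and>
     map (\<lambda>j. beta lam m ! (\<sigma> j - 1)) [1..<Suc m] = concat (map (beta_residue t lam m) [0..<t])"

lemma is_residue_sorting_exists:
  assumes "t \<ge> 1"
  shows "\<exists>\<sigma>. is_residue_sorting t lam m \<sigma>"
proof -
  define bs where "bs = beta lam m"
  define cs where "cs = concat (map (beta_residue t lam m) [0..<t])"
  have len: "length bs = m"
    by (simp add: bs_def beta_def)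
  have filt: "mset (concat (map (\<lambda>i. filter (\<lambda>b. b mod t = i) xs) [0..<k])) =
      mset (filter (\<lambda>b. b mod t < k) xs)" for xs k
    by (induction k) (auto simp: less_Suc_eq multiset_eq_iff)
  have "mset cs = mset bs"
    using filt[of bs t] assms by (simp add: cs_def bs_def beta_residue_def [abs_def])
  then obtain p where p: "p permutes {..<length bs}" "permute_list p bs = cs"
    by (rule mset_eq_permutation)
  define \<sigma> where "\<sigma> j = (if j \<in> {1..m} then Suc (p (j - 1)) else j)" for j
  have bij: "bij_betw p {..<m} {..<m}"
    using p(1) len by (simp add: permutes_imp_bij)
  have "bij_betw (Suc \<circ> (p \<circ> (\<lambda>j. j - 1))) {1..m} {1..m}"
  proof (intro bij_betw_trans[where B = "{..<m}"])
    show "bij_betw (\<lambda>j. j - 1) {1..m} {..<m}"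
      by (rule bij_betw_byWitness[where f' = Suc]) auto
    show "bij_betw Suc {..<m} {1..m}"
      by (rule bij_betw_byWitness[where f' = "\<lambda>j. j - 1"]) auto
  qed (fact bij)
  then have "bij_betw \<sigma> {1..m} {1..m}"
    by (rule bij_betw_cong[THEN iffD1, rotated]) (auto simp: \<sigma>_def)
  then have "\<sigma> permutes {1..m}"
    by (rule bij_imp_permutes) (auto simp: \<sigma>_def)
  moreover have "map (\<lambda>j. bs ! (\<sigma> j - 1)) [1..<Suc m] = cs"
    unfolding p(2)[symmetric] permute_list_def len
    by (rule nth_equalityI) (auto simp: \<sigma>_def simp del: upt_Suc)
  ultimately show ?thesis
    unfolding is_residue_sorting_def bs_def cs_def by blast
qed


section \<open>Characters\<close>

text \<open>
  Here \<open>mu\<close> is a sequence indexed from 1, of which the first \<^term>\<open>length ys\<close> entries are used,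
  while matrix and list positions are indexed from 0.
\<close>

definition schur_alternant :: "(nat \<Rightarrow> int) \<Rightarrow> 'a::field list \<Rightarrow> 'a" where
  "schur_alternant mu ys = (let N = length ys in
     det (mat N N (\<lambda>(i, j). ys ! i powi (mu (Suc j) + int N - int (Suc j)))))"

definition schur :: "(nat \<Rightarrow> int) \<Rightarrow> 'a::field list \<Rightarrow> 'a" where
  "schur mu ys = schur_alternant mu ys / schur_alternant (\<lambda>_. 0) ys"

definition so_alternant :: "(nat \<Rightarrow> int) \<Rightarrow> 'a::field list \<Rightarrow> 'a" where
  "so_alternant mu ys = (let N = length ys in
     det (mat N N (\<lambda>(i, j).
       ys ! i powi (mu (Suc j) + int N - int (Suc j) + 1) -
       ys ! i powi (- (mu (Suc j) + int N - int (Suc j))))))"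

definition so_char :: "(nat \<Rightarrow> int) \<Rightarrow> 'a::field list \<Rightarrow> 'a" where
  "so_char mu ys = so_alternant mu ys / so_alternant (\<lambda>_. 0) ys"


section \<open>Ingredients of the factorization\<close>

definition primitive_root_of_unity :: "nat \<Rightarrow> 'a::field \<Rightarrow> bool" where
  "primitive_root_of_unity t \<omega> \<longleftrightarrow> \<omega> ^ t = 1 \<and> (\<forall>k. 0 < k \<and> k < t \<longrightarrow> \<omega> ^ k \<noteq> 1)"

definition twisted :: "nat \<Rightarrow> 'a::field \<Rightarrow> 'a list \<Rightarrow> 'a list" where
  "twisted t \<omega> X = concat (map (\<lambda>k. map (\<lambda>x. \<omega> ^ k * x) X) [0..<t])"

definition mu3 :: "nat \<Rightarrow> nat \<Rightarrow> nat list \<Rightarrow> nat \<Rightarrow> nat \<Rightarrow> int" where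
  "mu3 t n lam i j =
     (let q = t_quotient t lam (t * n) in
      if j \<le> n_residue t lam (t * n) i
      then int (part (q (t - 1 - i)) 1) + int (part (q i) j)
      else int (part (q (t - 1 - i)) 1) - int (part (q (t - 1 - i)) (2 * n + 1 - j)))"

text \<open>
  The sum starts at \<open>\<lceil>t/2\<rceil>\<close>. For odd \<open>t\<close>, starting at \<open>\<lfloor>t/2\<rfloor>\<close> would add the
  term of the middle residue, which equals \<open>n + 1 choose 2\<close> when the core is self-conjugate;
  the factorization would then already fail for the empty partition with \<open>t = 3\<close> and \<open>n = 1\<close>,
  where the character is 1, the permutation is odd, and the sum must be odd.
\<close>

definition so_epsilon :: "nat \<Rightarrow> nat \<Rightarrow> nat list \<Rightarrow> nat \<Rightarrow> int" where
  "so_epsilon t n lam r =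
     - (\<Sum>i = (t + 1) div 2..t - 1. int ((n_residue t lam (t * n) i + 1) choose 2)) +
     (if odd t then int n * int r else 0)"

end

theory Submission
  imports Defs
begin

text \<open>
  After a discrete Fourier transform along \<open>k \<mapsto> \<omega> ^ k\<close>, row \<open>(q, i)\<close> of the alternant only meets the
  columns whose beta number is congruent to \<open>q - 1\<close> or \<open>- q\<close> modulo \<open>t\<close>. Hence the residues \<open>p\<close> and
  \<open>t - 1 - p\<close> together interact with exactly \<open>2 * n\<close> rows: the determinant vanishes unless
  \<open>n\<^sub>p + n\<^sub>t\<^sub>-\<^sub>1\<^sub>-\<^sub>p = 2 * n\<close> for all \<open>p\<close>, and otherwise it is a product of blocks, each a Schur
  alternant in \<open>X\<^sup>t\<close> and its inverses, with an odd orthogonal alternant in \<open>X\<^sup>t\<close> for the middle residue of an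
  odd \<open>t\<close>. The same row operations apply to the denominator, so only signs of column rearrangements remain.
  Removing a border strip of size \<open>t\<close> removes one cell of each content modulo \<open>t\<close>, so the numbers \<open>n\<^sub>i\<close>
  are those of the core; its Maya diagram is flush in each residue class, and conjugation
  reflects and complements it, which turns the balance condition into self-conjugacy.
\<close>

section \<open>Determinants indexed by lists\<close>

text \<open>No large determinant is evaluated. Numerator and denominator are multiplied by the same
  Fourier matrix and lose the same row factors, so these cancel and only have to be nonzero; the
  denominator is simply the case of the empty partition. Within a block, columns of residue
  \<open>t - 1 - p\<close> carry exponents \<open>- d - 1\<close> of \<open>x ^ t\<close>, with
  \<open>d\<close> the quotient of the beta number by \<open>t\<close>. They increase as the beta
  numbers decrease, so these columns are reversed and put behind those of residue \<open>p\<close>.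
  The exponents then decrease throughout and are those of \<open>mu3\<close> up to a constant shift,
  which costs nothing since the variables of the block multiply to 1. The delicate point is the
  sign. Sorting by residue gives \<open>sign \<sigma>\<close>; what remains is the reversing and
  moving of columns, the same for the empty partition together with its own sorting, and one factor
  -1 per column of residue \<open>t - 1 - p\<close>. For even \<open>t\<close> the total has the
  parity of \<open>so_epsilon\<close> by arithmetic alone. For odd \<open>t\<close> one also needs
  that the rank of the core has the parity of the sum of \<open>n_i + n\<close> over the upper
  residues; this is the origin of the term \<open>n * r\<close>.\<close>

definition ldet :: "('r \<Rightarrow> 'c \<Rightarrow> 'a::comm_ring_1) \<Rightarrow> 'r list \<Rightarrow> 'c list \<Rightarrow> 'a" where
  "ldet f R C = det (mat (length R) (length C) (\<lambda>(i, j). f (R ! i) (C ! j)))"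

lemma ldet_cong:
  assumes "\<And>r c. r \<in> set R \<Longrightarrow> c \<in> set C \<Longrightarrow> f r c = g r c"
  shows "ldet f R C = ldet g R C"
  unfolding ldet_def by (rule arg_cong[where f = det], rule eq_matI) (auto intro: assms)

lemma ldet_Nil [simp]: "ldet f [] [] = 1"
  by (simp add: ldet_def)

lemma ldet_map: "ldet f (map g R) (map h C) = ldet (\<lambda>r c. f (g r) (h c)) R C"
  unfolding ldet_def by (rule arg_cong[where f = det], rule eq_matI) auto

lemma ldet_append:
  fixes f :: "'r \<Rightarrow> 'c \<Rightarrow> 'a::idom"
  assumes "length R1 = length C1" "length R2 = length C2"
    and "\<And>r c. r \<in> set R1 \<Longrightarrow> c \<in> set C2 \<Longrightarrow> f r c = 0"
  shows "ldet f (R1 @ R2) (C1 @ C2) = ldet f R1 C1 * ldet f R2 C2"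
proof -
  let ?n = "length C1" and ?m = "length C2"
  define A1 where "A1 = mat ?n ?n (\<lambda>(i, j). f (R1 ! i) (C1 ! j))"
  define A3 where "A3 = mat ?m ?n (\<lambda>(i, j). f (R2 ! i) (C1 ! j))"
  define A4 where "A4 = mat ?m ?m (\<lambda>(i, j). f (R2 ! i) (C2 ! j))"
  have "mat (length (R1 @ R2)) (length (C1 @ C2)) (\<lambda>(i, j). f ((R1 @ R2) ! i) ((C1 @ C2) ! j))
      = four_block_mat A1 (0\<^sub>m ?n ?m) A3 A4"
    by (rule eq_matI) (auto simp: A1_def A3_def A4_def nth_append assms)
  moreover have "det (four_block_mat A1 (0\<^sub>m ?n ?m) A3 A4) = det A1 * det A4"
    by (rule det_four_block_mat_upper_right_zero) (auto simp: A1_def A3_def A4_def)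
  ultimately show ?thesis
    by (simp add: ldet_def A1_def A4_def assms)
qed

lemma ldet_concat:
  fixes f :: "'r \<Rightarrow> 'c \<Rightarrow> 'a::idom"
  assumes "\<And>p. p \<in> set ps \<Longrightarrow> length (R p) = length (C p)"
    and "\<And>p q r c. p \<in> set ps \<Longrightarrow> q \<in> set ps \<Longrightarrow> p \<noteq> q \<Longrightarrow> r \<in> set (R p) \<Longrightarrow> c \<in> set (C q)
      \<Longrightarrow> f r c = 0"
    and "distinct ps"
  shows "ldet f (concat (map R ps)) (concat (map C ps)) = (\<Prod>p\<in>set ps. ldet f (R p) (C p))"
  using assms
proof (induction ps)
  case (Cons p ps)
  have len: "length (concat (map R ps)) = length (concat (map C ps))"
    using Cons.prems(1) by (simp add: length_concat comp_def cong: map_cong)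
  have "ldet f (R p @ concat (map R ps)) (C p @ concat (map C ps))
      = ldet f (R p) (C p) * ldet f (concat (map R ps)) (concat (map C ps))"
    by (rule ldet_append) (use Cons.prems len in \<open>auto, metis\<close>)
  moreover have "ldet f (concat (map R ps)) (concat (map C ps)) = (\<Prod>p\<in>set ps. ldet f (R p) (C p))"
    using Cons.prems(1,3) by (intro Cons.IH Cons.prems(2)) auto
  ultimately show ?case
    using Cons.prems(3) by simp
qed simp

text \<open>Each Leibniz term takes one entry from every row and every column, so all terms collect
  the same product of factors.\<close>

lemma ldet_scale:
  fixes f :: "'r \<Rightarrow> 'c \<Rightarrow> 'a::comm_ring_1"
  assumes "length R = length C"
  shows "ldet (\<lambda>r c. u r * v c * f r c) R C = prod_list (map u R) * prod_list (map v C) * ldet f R C"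
proof -
  let ?N = "length C"
  have pl: "prod_list L = (\<Prod>i = 0..<length L. L ! i)" for L :: "'a list"
    by (simp add: prod.list_conv_set_nth)
  have *: "(\<Prod>i = 0..<?N. u (R ! i) * v (C ! p i) * f (R ! i) (C ! p i))
     = prod_list (map u R) * prod_list (map v C) * (\<Prod>i = 0..<?N. f (R ! i) (C ! p i))"
    if p: "p permutes {0..<?N}" for p
  proof -
    have "(\<Prod>i = 0..<?N. v (C ! p i)) = (\<Prod>i = 0..<?N. v (C ! i))"
      using prod.permute[OF p, of "\<lambda>i. v (C ! i)"] by (simp add: comp_def)
    then show ?thesis
      by (simp add: pl assms prod.distrib)
  qed
  have ix: "mat ?N ?N (\<lambda>(i, j). g (R ! i) (C ! j)) $$ (i, p i) = g (R ! i) (C ! p i)"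
    if "p permutes {0..<?N}" "i < ?N" for g :: "'r \<Rightarrow> 'c \<Rightarrow> 'a" and p i
    using that permutes_in_image[OF that(1), of i] by auto
  show ?thesis
    unfolding ldet_def assms det_def
    by (auto simp: sum_distrib_left ix * intro!: sum.cong)
qed

lemma ldet_permute:
  assumes "p permutes {..<length C}" "length R = length C"
  shows "ldet f R (map (\<lambda>j. C ! p j) [0..<length C]) = of_int (sign p) * ldet f R C"
proof -
  let ?N = "length C"
  define A where "A = mat ?N ?N (\<lambda>(i, j). f (R ! j) (C ! i))"
  have p: "p permutes {0..<?N}" using assms(1) by (simp add: atLeast0LessThan)
  have pin: "p j < ?N" if "j < ?N" for j
    using permutes_in_image[OF assms(1), of j] that by simp
  have "ldet f R (map (\<lambda>j. C ! p j) [0..<?N]) = det (mat ?N ?N (\<lambda>(i, j). f (R ! i) (C ! p j)))"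
    unfolding ldet_def assms(2) by (rule arg_cong[where f = det], rule eq_matI) auto
  \<comment> \<open>Transposition turns the permutation of columns into one of rows.\<close>
  also have "mat ?N ?N (\<lambda>(i, j). f (R ! i) (C ! p j)) = transpose_mat (mat ?N ?N (\<lambda>(i, j). A $$ (p i, j)))"
    by (rule eq_matI) (auto simp: A_def pin)
  also have "det \<dots> = det (mat ?N ?N (\<lambda>(i, j). A $$ (p i, j)))"
    by (rule det_transpose) auto
  also have "\<dots> = of_int (sign p) * det A"
    by (rule det_permute_rows[OF _ p]) (simp add: A_def)
  also have "det A = det (transpose_mat A)"
    by (rule det_transpose[where n = ?N, symmetric]) (simp add: A_def)
  also have "transpose_mat A = mat ?N ?N (\<lambda>(i, j). f (R ! i) (C ! j))"
    by (rule eq_matI) (auto simp: A_def)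
  finally show ?thesis
    by (simp add: ldet_def assms(2))
qed

lemma ldet_mult:
  assumes "length R = length K" "length K = length C"
  shows "ldet f R K * ldet g K C = ldet (\<lambda>r c. \<Sum>k\<leftarrow>K. f r k * g k c) R C"
proof -
  let ?N = "length C"
  define F where "F = mat ?N ?N (\<lambda>(i, j). f (R ! i) (K ! j))"
  define G where "G = mat ?N ?N (\<lambda>(i, j). g (K ! i) (C ! j))"
  have "det (F * G) = det F * det G"
    by (rule det_mult[where n = ?N]) (auto simp: F_def G_def)
  moreover have "F * G = mat ?N ?N (\<lambda>(i, j). \<Sum>k\<leftarrow>K. f (R ! i) k * g k (C ! j))"
    by (rule eq_matI)
      (auto simp: F_def G_def scalar_prod_def sum_list_sum_nth assms intro!: sum.cong)
  ultimately show ?thesis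
    by (simp add: ldet_def F_def G_def assms)
qed

lemma ldet_identity:
  assumes "distinct L"
  shows "ldet (\<lambda>r c. of_bool (r = c)) L L = (1 :: 'a::comm_ring_1)"
proof -
  have "mat (length L) (length L) (\<lambda>(i, j). of_bool (L ! i = L ! j)) = (1\<^sub>m (length L) :: 'a mat)"
    by (rule eq_matI) (auto simp: nth_eq_iff_index_eq assms)
  then show ?thesis by (simp add: ldet_def)
qed

text \<open>A nonzero determinant has a nonzero Leibniz term, that is, a bijection from rows to
  columns through nonzero entries. If such entries join only rows and columns of the same class,
  each class has as many rows as columns. The vanishing part of the theorem rests on the
  contrapositive.\<close>

lemma ldet_nonzero_classes:
  assumes "ldet f R C \<noteq> 0"
    and "\<And>r c. r \<in> set R \<Longrightarrow> c \<in> set C \<Longrightarrow> f r c \<noteq> 0 \<Longrightarrow> u r = v c"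
  shows "mset (map u R) = mset (map v C)"
proof -
  let ?N = "length R" and ?M = "mat (length R) (length C) (\<lambda>(i, j). f (R ! i) (C ! j))"
  \<comment> \<open>\<open>det\<close> is 0 on a matrix that is not square.\<close>
  have len: "length R = length C"
    using assms(1) by (auto simp: ldet_def det_def split: if_splits)
  have "\<exists>p. p permutes {0..<?N} \<and> (\<Prod>i = 0..<?N. ?M $$ (i, p i)) \<noteq> 0"
  proof (rule ccontr)
    assume "\<not> ?thesis"
    then have "ldet f R C = 0"
      unfolding ldet_def det_def by (auto intro!: sum.neutral)
    with assms(1) show False by simp
  qed
  then obtain p where p: "p permutes {0..<?N}" and nz: "(\<Prod>i = 0..<?N. ?M $$ (i, p i)) \<noteq> 0"
    by blast
  have pin: "p i < ?N" if "i < ?N" for i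
    using permutes_in_image[OF p, of i] that by simp
  have "u (R ! i) = v (C ! p i)" if "i < ?N" for i
  proof -
    have "?M $$ (i, p i) \<noteq> 0"
      using nz that by (metis (no_types, lifting) atLeastLessThan_iff finite_atLeastLessThan le0 prod_zero)
    then show ?thesis
      using that pin[OF that] len by (auto intro!: assms(2))
  qed
  then have "map u R = permute_list p (map v C)"
    by (intro nth_equalityI) (auto simp: permute_list_def len pin[unfolded len])
  then show ?thesis
    using p len by (simp add: mset_permute_list atLeast0LessThan)
qed

section \<open>Counting neighbour transpositions\<close>

text \<open>\<open>k\<close> is the length of one particular path of neighbour exchanges, not the
  number of inversions: counts simply add up, entries may repeat, and the sign of the rearrangement
  depends only on the parity of \<open>k\<close>.\<close>

inductive swaps :: "nat \<Rightarrow> 'a list \<Rightarrow> 'a list \<Rightarrow> bool" where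
  swaps_refl: "swaps 0 L L"
| swaps_step: "swaps k L (A @ x # y # B) \<Longrightarrow> swaps (Suc k) L (A @ y # x # B)"

lemma swaps_trans:
  assumes "swaps l L' L''" "swaps k L L'"
  shows "swaps (k + l) L L''"
  using assms by induction (auto intro: swaps.intros)

lemma swaps_context:
  assumes "swaps k L L'"
  shows "swaps k (A @ L @ B) (A @ L' @ B)"
  using assms
proof induction
  case (swaps_step k L P x y Q)
  then show ?case
    using swaps.swaps_step[of k "A @ L @ B" "A @ P" x y "Q @ B"] by simp
qed (rule swaps_refl)

lemma swaps_prefix: "swaps k L L' \<Longrightarrow> swaps k (A @ L) (A @ L')"
  using swaps_context[of k L L' A "[]"] by simp

lemma swaps_suffix: "swaps k L L' \<Longrightarrow> swaps k (L @ B) (L' @ B)"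
  using swaps_context[of k L L' "[]" B] by simp

lemma swaps_Cons: "swaps (length A) (x # A) (A @ [x])"
proof (induction A)
  case (Cons a A)
  have "swaps 1 (x # a # A) (a # x # A)"
    using swaps_step[of 0 "x # a # A" "[]" x a A] by (simp add: swaps_refl)
  moreover have "swaps (length A) (a # x # A) (a # A @ [x])"
    using swaps_prefix[OF Cons.IH, of "[a]"] by simp
  ultimately show ?case
    using swaps_trans by fastforce
qed (simp add: swaps_refl)

lemma swaps_append: "swaps (length A * length B) (A @ B) (B @ A)"
proof (induction A)
  case (Cons a A)
  have "swaps (length A * length B) (a # A @ B) (a # B @ A)"
    using swaps_prefix[OF Cons.IH, of "[a]"] by simp
  moreover have "swaps (length B) (a # B @ A) (B @ a # A)"
    using swaps_suffix[OF swaps_Cons[of B a], of A] by simp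
  ultimately show ?case
    using swaps_trans by (fastforce simp: add.commute)
qed (simp add: swaps_refl)

lemma swaps_rev: "swaps (length A choose 2) A (rev A)"
proof (induction A)
  case (Cons a A)
  have "swaps (length A choose 2) (a # A) (a # rev A)"
    using swaps_prefix[OF Cons.IH, of "[a]"] by simp
  moreover have "swaps (length A) (a # rev A) (rev A @ [a])"
    using swaps_Cons[of "rev A" a] by simp
  ultimately have "swaps ((length A choose 2) + length A) (a # A) (rev (a # A))"
    using swaps_trans by fastforce
  then show ?case
    by (simp add: numeral_2_eq_2 add.commute)
qed (simp add: swaps_refl numeral_2_eq_2)

lemma swaps_length: "swaps k L L' \<Longrightarrow> length L' = length L"
  by (induction rule: swaps.induct) auto

lemma ldet_swaps:
  assumes "swaps k L L'" "length R = length L"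
  shows "ldet f R L' = (- 1) ^ k * ldet f R L"
  using assms
proof induction
  case (swaps_step k L A x y B)
  let ?C = "A @ x # y # B" and ?C' = "A @ y # x # B" and ?N = "length A + (length B + 2)"
  have len: "length R = ?N"
    using swaps_length[OF swaps_step.hyps] swaps_step.prems by simp
  have "mat ?N ?N (\<lambda>(i, j). f (R ! i) (?C' ! j))
      = swapcols (length A) (Suc (length A)) (mat ?N ?N (\<lambda>(i, j). f (R ! i) (?C ! j)))"
    by (rule eq_matI) (auto simp: nth_append nth_Cons')
  then have "ldet f R ?C' = - ldet f R ?C"
    by (simp add: ldet_def len det_swapcols[where n = ?N])
  then show ?case
    using swaps_step by simp
qed simp

section \<open>Partitions and Maya diagrams\<close>

lemma part_antimono:
  assumes "is_partition lam" "1 \<le> i" "i \<le> j"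
  shows "part lam j \<le> part lam i"
proof (cases "i < j \<and> j \<le> length lam")
  case True
  then have "i - 1 < j - 1" "j - 1 < length lam" using assms(2) by auto
  then have "lam ! (j - 1) \<le> lam ! (i - 1)"
    using assms(1) unfolding is_partition_def by (auto simp: sorted_wrt_iff_nth_less)
  then show ?thesis using True assms(2) by (simp add: part_def)
next
  case False
  then show ?thesis using assms by (auto simp: part_def dest: le_neq_implies_less)
qed

lemma part_pos:
  assumes "is_partition lam" "1 \<le> i" "i \<le> length lam"
  shows "0 < part lam i"
proof -
  have "lam ! (i - 1) \<in> set lam" using assms by auto
  moreover have "0 \<notin> set lam" using assms(1) by (simp add: is_partition_def)
  ultimately have "lam ! (i - 1) \<noteq> 0" by metis
  then show ?thesis using assms by (simp add: part_def)
qed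

lemma part_beyond [simp]: "length lam < i \<Longrightarrow> part lam i = 0"
  by (simp add: part_def)

lemma mem_diagram_iff: "(i, j) \<in> diagram lam \<longleftrightarrow> 1 \<le> i \<and> 1 \<le> j \<and> j \<le> part lam i"
  by (auto simp: diagram_def part_def)

lemma diagram_down_closed:
  assumes "is_partition lam" "(i, j) \<in> diagram lam" "1 \<le> i'" "i' \<le> i" "1 \<le> j'" "j' \<le> j"
  shows "(i', j') \<in> diagram lam"
  using assms part_antimono[OF assms(1,3,4)] by (auto simp: mem_diagram_iff)

lemma partition_eqI:
  assumes "is_partition lam" "is_partition mu" "\<And>j. 1 \<le> j \<Longrightarrow> part lam j = part mu j"
  shows "lam = mu"
proof -
  have le: "length kap \<le> length nu"
    if "is_partition kap" "\<And>j. 1 \<le> j \<Longrightarrow> part kap j = part nu j" for kap nu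
  proof (rule ccontr)
    assume "\<not> ?thesis"
    then have "0 < part nu (length kap)"
      using part_pos[OF that(1), of "length kap"] that(2)[of "length kap"] by simp
    with \<open>\<not> ?thesis\<close> show False by simp
  qed
  have len: "length lam = length mu"
    using le[of lam mu] le[of mu lam] assms by simp
  show ?thesis
  proof (rule nth_equalityI[OF len])
    fix i assume "i < length lam"
    then show "lam ! i = mu ! i"
      using assms(3)[of "Suc i"] len by (simp add: part_def)
  qed
qed

text \<open>A partition has no zero parts, so \<open>f\<close> is cut off at its first zero;
  antitonicity makes all later values 0.\<close>

lemma partition_exists:
  assumes anti: "\<And>i j. 1 \<le> i \<Longrightarrow> i \<le> j \<Longrightarrow> f j \<le> f i" and zero: "\<And>i. L < i \<Longrightarrow> f i = 0"
  shows "\<exists>mu. is_partition mu \<and> (\<forall>i\<ge>1. part mu i = f i)"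
proof -
  define l where "l = (LEAST l. f (Suc l) = 0)"
  have fl: "f (Suc l) = 0"
    unfolding l_def by (rule LeastI[of "\<lambda>l. f (Suc l) = 0" L]) (simp add: zero)
  have pos: "f (Suc i) \<noteq> 0" if "i < l" for i
    using not_less_Least[OF that[unfolded l_def]] .
  define mu where "mu = map (\<lambda>i. f (Suc i)) [0..<l]"
  have "is_partition mu"
    unfolding is_partition_def mu_def by (auto simp: sorted_wrt_iff_nth_less intro!: anti dest: pos)
  moreover have "part mu i = f i" if "1 \<le> i" for i
  proof (cases "i \<le> l")
    case True
    then have "[0..<l] ! (i - 1) = i - 1" using that by (subst nth_upt) auto
    then show ?thesis using that True by (simp add: part_def mu_def)
  next
    case False
    then have "f i \<le> f (Suc l)" by (intro anti) auto
    then show ?thesis using fl False by (simp add: part_def mu_def)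
  qed
  ultimately show ?thesis by blast
qed

text \<open>Both sides say that the cell \<open>(i, j)\<close> lies in the diagram: by antitonicity
  the rows with at least \<open>j\<close> cells form an initial segment, whose length is the
  \<open>j\<close>-th part of the conjugate. Everything about \<open>conjugate\<close> below is
  derived from this Galois connection.\<close>

lemma le_part_iff_le_part_conjugate:
  assumes "is_partition lam" "1 \<le> i" "1 \<le> j"
  shows "j \<le> part lam i \<longleftrightarrow> i \<le> part (conjugate lam) j"
proof -
  define A where "A = {k \<in> {1..length lam}. j \<le> part lam k}"
  have fin: "finite A" by (simp add: A_def)
  have c: "part (conjugate lam) j = card A"
  proof (cases "j \<le> part lam 1")
    case True
    moreover have "[1..<Suc (part lam 1)] ! (j - 1) = j"
      using True assms(3) by (subst nth_upt) auto
    ultimately show ?thesis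
      using assms(3) unfolding conjugate_def by (subst part_def) (simp add: A_def del: upt_Suc)
  next
    case False
    then have "A = {}" using part_antimono[OF assms(1), of 1] by (force simp: A_def)
    then show ?thesis using False by (simp add: part_def conjugate_def del: upt_Suc)
  qed
  show ?thesis
  proof
    assume "j \<le> part lam i"
    then have "{1..i} \<subseteq> A"
      using part_antimono[OF assms(1), of _ i] assms(3)
      by (force simp: A_def part_def split: if_splits)
    then show "i \<le> part (conjugate lam) j"
      using card_mono[OF fin, of "{1..i}"] c by simp
  next
    assume i: "i \<le> part (conjugate lam) j"
    show "j \<le> part lam i"
    proof (rule ccontr)
      assume "\<not> ?thesis"
      then have "A \<subseteq> {1..<i}"
        by (auto simp: A_def not_le not_less)
          (meson assms(1,2) leD leI less_le_trans part_antimono)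
      then have "card A \<le> i - 1"
        using card_mono[of "{1..<i}" A] by simp
      then show False using i c assms(2) by simp
    qed
  qed
qed

lemma is_partition_conjugate:
  assumes "is_partition lam"
  shows "is_partition (conjugate lam)"
proof -
  have len: "length (conjugate lam) = part lam 1"
    by (simp add: conjugate_def)
  have nz: "0 < part (conjugate lam) j" if "1 \<le> j" "j \<le> part lam 1" for j
    using le_part_iff_le_part_conjugate[OF assms, of 1 j] that by simp
  have anti: "part (conjugate lam) j \<le> part (conjugate lam) i" if "1 \<le> i" "i \<le> j" for i j
  proof (cases "part (conjugate lam) j = 0")
    case False
    let ?k = "part (conjugate lam) j"
    have "j \<le> part lam ?k"
      using le_part_iff_le_part_conjugate[OF assms, of ?k j] that False by simp
    then show ?thesis
      using le_part_iff_le_part_conjugate[OF assms, of ?k i] that False by simp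
  qed simp
  have nth: "conjugate lam ! i = part (conjugate lam) (Suc i)" if "i < part lam 1" for i
    using that len by (simp add: part_def)
  show ?thesis
    unfolding is_partition_def
    using nz anti by (auto simp: sorted_wrt_iff_nth_less len nth in_set_conv_nth)
qed

text \<open>The Maya diagram of a partition; shifting it by \<open>m\<close> and discarding negative
  positions gives the beta set \<open>beta lam m\<close>.\<close>

definition beads :: "nat list \<Rightarrow> int set" where
  "beads lam = {int (part lam j) - int j |j. 1 \<le> j}"

lemma bead_less:
  assumes "is_partition lam" "1 \<le> i" "i < j"
  shows "int (part lam j) - int j < int (part lam i) - int i"
  using part_antimono[OF assms(1,2), of j] assms(3) by simp

text \<open>The \<open>j\<close>-th part is read off the \<open>j\<close>-th largest bead. If the
  partitions agree before \<open>j\<close> and one has the smaller \<open>j\<close>-th bead, the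
  larger bead must occur in it before position \<open>j\<close>, where both share beads that are
  larger still.\<close>

lemma beads_inject:
  assumes "is_partition lam" "is_partition mu" "beads lam = beads mu"
  shows "lam = mu"
proof (rule partition_eqI[OF assms(1,2)])
  have neq: "\<not> int (part kap j) - int j < int (part nu j) - int j"
    if "is_partition kap" "is_partition nu" "beads kap = beads nu"
      "\<And>k. 1 \<le> k \<Longrightarrow> k < j \<Longrightarrow> part kap k = part nu k" "1 \<le> j" for kap nu j
  proof
    assume less: "int (part kap j) - int j < int (part nu j) - int j"
    have "int (part nu j) - int j \<in> beads kap"
      using that(3,5) by (auto simp: beads_def)
    then obtain k where k: "1 \<le> k" "int (part nu j) - int j = int (part kap k) - int k"
      by (auto simp: beads_def)
    have "k < j"
    proof (rule ccontr)
      assume "\<not> k < j"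
      then show False
        using less k bead_less[OF that(1,5), of k] by (cases "k = j") auto
    qed
    then show False
      using bead_less[OF that(2) k(1), of j] that(4)[OF k(1)] k(2) by simp
  qed
  show "part lam j = part mu j" if "1 \<le> j" for j
    using that
  proof (induction j rule: less_induct)
    case (less j)
    have *: "part lam k = part mu k" if "1 \<le> k" "k < j" for k
      using less that by blast
    show ?case
      using neq[OF assms(1,2,3) * less.prems]
        neq[OF assms(2,1) assms(3)[symmetric] *[symmetric] less.prems] by linarith
  qed
qed

lemma gap_conjugate:
  assumes "is_partition lam" "s \<notin> beads lam"
  shows "\<exists>j\<ge>1. s = int j - 1 - int (part (conjugate lam) j)"
proof -
  let ?P = "\<lambda>k. int (part lam (Suc k)) - int (Suc k) < s"
  \<comment> \<open>\<open>i\<close> is the number of beads above the gap \<open>s\<close>: bead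
    \<open>i\<close> is the last one above it and bead \<open>Suc i\<close> the first one
    below.\<close>
  define i where "i = (LEAST k. ?P k)"
  have "?P (length lam + nat \<bar>s\<bar>)" by simp
  then have i: "?P i" unfolding i_def by (rule LeastI)
  have *: "s < int (part lam i) - int i" if "i > 0"
  proof -
    have "i - 1 < (LEAST k. ?P k)" using that i_def by simp
    then have "\<not> ?P (i - 1)" by (rule not_less_Least)
    then have "s \<le> int (part lam i) - int i" using that by simp
    moreover have "s \<noteq> int (part lam i) - int i" using assms(2) that by (auto simp: beads_def)
    ultimately show ?thesis by simp
  qed
  \<comment> \<open>Chosen so that \<open>s = j - 1 - i\<close>. The positions of the beads around
    \<open>s\<close> say that row \<open>i\<close> reaches column \<open>j\<close> and row
    \<open>Suc i\<close> does not, so column \<open>j\<close> has length \<open>i\<close>.\<close>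
  define j where "j = nat (s + 1 + int i)"
  have j: "int j = s + 1 + int i" "1 \<le> j"
    using i by (auto simp: j_def)
  have "\<not> Suc i \<le> part (conjugate lam) j"
    using le_part_iff_le_part_conjugate[OF assms(1), of "Suc i" j] i j by simp
  moreover have "i \<le> part (conjugate lam) j"
    using le_part_iff_le_part_conjugate[OF assms(1), of i j] * j by (cases "i = 0") auto
  ultimately have "part (conjugate lam) j = i" by simp
  then show ?thesis using j by (intro exI[of _ j]) simp
qed

lemma beads_conjugate:
  assumes "is_partition lam"
  shows "s \<in> beads (conjugate lam) \<longleftrightarrow> - 1 - s \<notin> beads lam"
proof
  assume "s \<in> beads (conjugate lam)"
  then obtain j where j: "1 \<le> j" "s = int (part (conjugate lam) j) - int j"
    by (auto simp: beads_def)
  show "- 1 - s \<notin> beads lam"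
  proof
    assume "- 1 - s \<in> beads lam"
    then obtain i where i: "1 \<le> i" "- 1 - s = int (part lam i) - int i"
      by (auto simp: beads_def)
    \<comment> \<open>A common position would give
      \<open>part lam i + part (conjugate lam) j = i + j - 1\<close>. By the Galois connection the
      sum is at least \<open>i + j\<close> if the cell \<open>(i, j)\<close> is in the diagram and
      at most \<open>i + j - 2\<close> if it is not.\<close>
    show False
      using le_part_iff_le_part_conjugate[OF assms i(1) j(1)] i(2) j(2) by linarith
  qed
next
  assume "- 1 - s \<notin> beads lam"
  from gap_conjugate[OF assms this] show "s \<in> beads (conjugate lam)"
    by (force simp: beads_def)
qed

lemma self_conjugate_iff_beads:
  assumes "is_partition lam"
  shows "self_conjugate lam \<longleftrightarrow> (\<forall>s. s \<in> beads lam \<longleftrightarrow> - 1 - s \<notin> beads lam)"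
proof -
  have "self_conjugate lam \<longleftrightarrow> beads (conjugate lam) = beads lam"
    using beads_inject[OF is_partition_conjugate[OF assms] assms]
    by (auto simp: self_conjugate_def)
  then show ?thesis
    using beads_conjugate[OF assms] by blast
qed

section \<open>Contents of border strips and invariance of the residue counts\<close>

definition cell_content :: "nat \<times> nat \<Rightarrow> int" where
  "cell_content c = int (snd c) - int (fst c)"

text \<open>Two strip cells on one diagonal would force a 2 by 2 square at the upper left one,
  because a difference of diagrams contains all cells between them; so contents are distinct.
  Adjacent cells differ by 1 in content, so a path inside the strip cannot jump over a value; so
  contents form an interval.\<close>

lemma border_strip_contents:
  assumes "removes_border_strip t lam mu"
  shows "\<exists>c. bij_betw cell_content (diagram lam - diagram mu) {c..<c + int t}"
proof -
  define D where "D = diagram lam - diagram mu"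
  have lam: "is_partition lam" and mu: "is_partition mu" and card: "card D = t"
    and conn: "cells_connected D" and sq: "\<not> has_square D"
    using assms by (auto simp: removes_border_strip_def D_def)
  have fin: "finite D" by (simp add: D_def finite_diagram)
  have no_diag: False if "(i, j) \<in> D" "(i + d, j + d) \<in> D" "0 < d" for i j d
  proof -
    have ij: "1 \<le> i" "1 \<le> j" using that(1) by (auto simp: D_def mem_diagram_iff)
    have "(i', j') \<in> D" if "i' \<in> {i, Suc i}" "j' \<in> {j, Suc j}" for i' j'
    proof -
      have "(i', j') \<in> diagram lam"
        by (rule diagram_down_closed[OF lam, of "i + d" "j + d"])
          (use that ij \<open>(i + d, j + d) \<in> D\<close> \<open>0 < d\<close> in \<open>auto simp: D_def\<close>)
      moreover have "(i', j') \<notin> diagram mu"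
        using diagram_down_closed[OF mu, of i' j' i j] that ij \<open>(i, j) \<in> D\<close> by (auto simp: D_def)
      ultimately show ?thesis by (simp add: D_def)
    qed
    then have "{(i, j), (Suc i, j), (i, Suc j), (Suc i, Suc j)} \<subseteq> D" by auto
    with sq show False unfolding has_square_def by blast
  qed
  have "inj_on cell_content D"
  proof (rule inj_onI, rule ccontr)
    fix c d assume cd: "c \<in> D" "d \<in> D" "cell_content c = cell_content d" "c \<noteq> d"
    obtain i j i' j' where eq: "c = (i, j)" "d = (i', j')" by fastforce
    have *: "int j - int i = int j' - int i'" using cd(3) eq by (simp add: cell_content_def)
    show False
    proof (cases i i' rule: linorder_cases)
      case less
      then have "j' = j + (i' - i)" using * by linarith
      then show False using no_diag[of i j "i' - i"] cd eq less by simp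
    next
      case equal
      then show False using * cd eq by simp
    next
      case greater
      then have "j = j' + (i - i')" using * by linarith
      then show False using no_diag[of i' j' "i - i'"] cd eq greater by simp
    qed
  qed
  have interval: "z \<in> cell_content ` D" if "c \<in> D" "d \<in> D" "cell_content c \<le> z" "z \<le> cell_content d" for c d z
  proof (rule ccontr)
    assume z: "z \<notin> cell_content ` D"
    have "(c, d) \<in> {(a, b). a \<in> D \<and> b \<in> D \<and> adjacent a b}\<^sup>*"
      using conn that unfolding cells_connected_def by blast
    then have "cell_content d < z"
    proof (induction rule: rtrancl_induct)
      case base
      then show ?case using that z by (metis imageI order_le_imp_less_or_eq)
    next
      case (step a b)
      then have "\<bar>cell_content a - cell_content b\<bar> \<le> 1" "b \<in> D"
        by (auto simp: cell_content_def adjacent_def)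
      moreover have "cell_content b \<noteq> z" using z \<open>b \<in> D\<close> by auto
      ultimately show ?case using step.IH by linarith
    qed
    with that show False by simp
  qed
  show ?thesis
  proof (cases "D = {}")
    case True
    then show ?thesis using card by (simp add: D_def[symmetric] bij_betw_def)
  next
    case False
    let ?C = "cell_content ` D"
    have finC: "finite ?C" "?C \<noteq> {}" using fin False by auto
    have C: "?C = {Min ?C..Max ?C}"
    proof (intro equalityI subsetI)
      fix z assume "z \<in> {Min ?C..Max ?C}"
      moreover obtain c d where "c \<in> D" "cell_content c = Min ?C" "d \<in> D" "cell_content d = Max ?C"
        using Min_in[OF finC] Max_in[OF finC] by (metis imageE)
      ultimately show "z \<in> ?C" using interval by auto
    qed (use finC in auto)
    have "int t = Max ?C + 1 - Min ?C"
    proof -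
      have "t = card ?C" using card card_image[OF \<open>inj_on cell_content D\<close>] by simp
      also have "\<dots> = card {Min ?C..Max ?C}" by (simp flip: C)
      finally show ?thesis using Min_le[OF finC(1) Max_in[OF finC]] by simp
    qed
    then have "?C = {Min ?C..<Min ?C + int t}" using C by auto
    then show ?thesis
      unfolding D_def[symmetric] bij_betw_def using \<open>inj_on cell_content D\<close> by blast
  qed
qed

lemma removes_border_strip_length:
  assumes "removes_border_strip t lam mu"
  shows "length mu \<le> length lam"
proof (cases "mu = []")
  case False
  then have "(length mu, 1) \<in> diagram mu"
    using part_pos[of mu "length mu"] assms
    by (auto simp: mem_diagram_iff removes_border_strip_def Suc_le_eq)
  then have "(length mu, 1) \<in> diagram lam"
    using assms by (auto simp: removes_border_strip_def)
  then show ?thesis by (simp add: diagram_def)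
qed simp

lemma n_residue_eq_sum:
  "n_residue t lam m i = (\<Sum>j = 1..m. of_bool ((part lam j + m - j) mod t = i))"
proof -
  have "length (filter P (map f xs)) = (\<Sum>x\<leftarrow>xs. of_bool (P (f x)))" for P f and xs :: "nat list"
    by (induction xs) auto
  then have "n_residue t lam m i = (\<Sum>j\<leftarrow>[1..<Suc m]. of_bool ((part lam j + m - j) mod t = i))"
    unfolding n_residue_def beta_residue_def beta_def .
  then show ?thesis
    by (simp add: sum_list_distinct_conv_sum_set atLeastLessThanSuc_atLeastAtMost del: upt_Suc)
qed

text \<open>Start from the empty partition, whose row \<open>j\<close> has its bead at
  \<open>- j\<close>. Adding a cell of content \<open>c\<close> moves the bead of its row from
  \<open>c - 1\<close> to \<open>c\<close>, so the differences of \<open>h\<close> telescope along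
  each row.\<close>

lemma n_residue_content_sum:
  fixes t m i :: nat and h :: "int \<Rightarrow> int"
  defines "h \<equiv> \<lambda>x. of_bool ((int m + x) mod int t = int i)"
  assumes "length lam \<le> m"
  shows "int (n_residue t lam m i) =
    (\<Sum>j = 1..m. h (- int j)) + (\<Sum>c\<in>diagram lam. h (cell_content c) - h (cell_content c - 1))"
proof -
  have tele: "(\<Sum>k = 1..p. h (int k - int j) - h (int k - int j - 1)) = h (int p - int j) - h (- int j)"
    for p j by (induction p) auto
  have D: "diagram lam = (SIGMA j:{1..m}. {1..part lam j})"
    using assms by (auto simp: mem_diagram_iff part_def split: if_splits)
  have "(\<Sum>c\<in>diagram lam. h (cell_content c) - h (cell_content c - 1))
      = (\<Sum>j = 1..m. \<Sum>k = 1..part lam j. h (int k - int j) - h (int k - int j - 1))"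
    unfolding D by (subst sum.Sigma) (auto simp: cell_content_def split_def)
  also have "\<dots> = (\<Sum>j = 1..m. h (int (part lam j) - int j) - h (- int j))"
    by (simp only: tele)
  finally have "(\<Sum>j = 1..m. h (- int j)) + (\<Sum>c\<in>diagram lam. h (cell_content c) - h (cell_content c - 1))
      = (\<Sum>j = 1..m. h (int (part lam j) - int j))"
    by (simp add: sum_subtractf)
  also have "\<dots> = (\<Sum>j = 1..m. of_bool ((part lam j + m - j) mod t = i))"
  proof (rule sum.cong[OF refl])
    fix j assume "j \<in> {1..m}"
    then have "int m + (int (part lam j) - int j) = int (part lam j + m - j)"
      by (simp add: of_nat_diff)
    then have "(int m + (int (part lam j) - int j)) mod int t = int ((part lam j + m - j) mod t)"
      by (simp only: zmod_int)
    then show "h (int (part lam j) - int j) = of_bool ((part lam j + m - j) mod t = i)"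
      by (simp add: h_def)
  qed
  finally show ?thesis by (simp add: n_residue_eq_sum)
qed

text \<open>Over the \<open>t\<close> consecutive contents of the strip the differences telescope to
  \<open>h (c + t - 1) - h (c - 1)\<close>, which is 0 because \<open>h\<close> has period
  \<open>t\<close>.\<close>

lemma n_residue_removes_border_strip:
  assumes "removes_border_strip t lam mu" "length lam \<le> m"
  shows "n_residue t mu m i = n_residue t lam m i"
proof -
  define h :: "int \<Rightarrow> int" where "h = (\<lambda>x. of_bool ((int m + x) mod int t = int i))"
  define g where "g x = h x - h (x - 1)" for x
  obtain c where c: "bij_betw cell_content (diagram lam - diagram mu) {c..<c + int t}"
    using border_strip_contents[OF assms(1)] by blast
  have tele: "(\<Sum>x\<in>{c..<c + int k}. g x) = h (c + int k - 1) - h (c - 1)" for k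
  proof (induction k)
    case (Suc k)
    have "{c..<c + int (Suc k)} = insert (c + int k) {c..<c + int k}" by auto
    then show ?case using Suc by (simp add: g_def)
  qed simp
  have "h (c + int t - 1) = h (c - 1)"
  proof -
    have "(int m + (c + int t - 1)) mod int t = (int m + (c - 1) + int t) mod int t"
      by (simp add: algebra_simps)
    then show ?thesis by (simp add: h_def)
  qed
  then have 0: "(\<Sum>d\<in>diagram lam - diagram mu. g (cell_content d)) = 0"
    using sum.reindex_bij_betw[OF c, of g] tele[of t] by simp
  have sub: "diagram mu \<subseteq> diagram lam" using assms by (simp add: removes_border_strip_def)
  have "(\<Sum>d\<in>diagram lam. g (cell_content d)) = (\<Sum>d\<in>diagram mu. g (cell_content d))"
    using sum.subset_diff[OF sub finite_diagram, of "\<lambda>d. g (cell_content d)"] 0 by simp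
  moreover have "length mu \<le> m"
    using removes_border_strip_length[OF assms(1)] assms(2) by simp
  ultimately have "int (n_residue t mu m i) = int (n_residue t lam m i)"
    using n_residue_content_sum[of lam m t i] n_residue_content_sum[of mu m t i] assms(2)
    by (simp add: g_def h_def)
  then show ?thesis by simp
qed

lemma core_invariants:
  assumes "is_core_of t rho lam" "is_partition lam" "length lam \<le> m"
  shows "is_partition rho" "length rho \<le> m" "n_residue t rho m i = n_residue t lam m i"
proof -
  have "(removes_border_strip t)\<^sup>*\<^sup>* lam rho" using assms by (simp add: is_core_of_def)
  then have "is_partition rho \<and> length rho \<le> m \<and> n_residue t rho m i = n_residue t lam m i"
  proof (induction rule: rtranclp_induct)
    case (step y z)
    then show ?case
      using n_residue_removes_border_strip[of t y z m i] removes_border_strip_length[of t y z]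
      by (simp add: removes_border_strip_def)
  qed (use assms in simp)
  then show "is_partition rho" "length rho \<le> m" "n_residue t rho m i = n_residue t lam m i"
    by auto
qed

text \<open>Suppose \<open>s\<close> is a bead and \<open>s - t\<close> a gap. The row
  \<open>a\<close> of the bead and the column \<open>j\<close> of the gap meet in a cell of the
  diagram, and a strip of size \<open>t\<close> can be removed that ends in row \<open>e\<close>,
  the last row of column \<open>j\<close>.\<close>

lemma beads_closed_if_no_border_strip:
  assumes lam: "is_partition lam" and core: "\<nexists>mu. removes_border_strip t lam mu"
    and s: "s \<in> beads lam" and t: "1 \<le> t"
  shows "s - int t \<in> beads lam"
proof (rule ccontr)
  assume "s - int t \<notin> beads lam"
  then obtain j where j: "1 \<le> j" and sj: "s - int t = int j - 1 - int (part (conjugate lam) j)"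
    using gap_conjugate[OF lam] by blast
  obtain a where a: "1 \<le> a" and sa: "s = int (part lam a) - int a"
    using s by (auto simp: beads_def)
  define e where "e = part (conjugate lam) j"
  define P where "P = part lam"
  have gal: "j \<le> P i \<longleftrightarrow> i \<le> e" if "1 \<le> i" for i
    using le_part_iff_le_part_conjugate[OF lam that j] by (simp add: e_def P_def)
  have anti: "P i' \<le> P i" if "1 \<le> i" "i \<le> i'" for i i'
    using part_antimono[OF lam that] by (simp add: P_def)
  have ae: "a \<le> e"
  proof (rule ccontr)
    assume "\<not> a \<le> e"
    then show False
      using gal[OF a] sa sj t by (simp add: P_def e_def)
  qed
  \<comment> \<open>The cell \<open>(a, j)\<close> has hook length \<open>t\<close>; the strip removed is its rim hook.\<close>
  define f where "f i = (if i < a \<or> e < i then P i else if i < e then P (Suc i) - 1 else j - 1)" for i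
  have f_le: "f i \<le> P i" if "1 \<le> i" for i
    using anti[OF that, of "Suc i"] gal[OF that] by (auto simp: f_def)
  have f_anti: "f i' \<le> f i" if "1 \<le> i" "i \<le> i'" for i i'
  proof (cases "i < a \<or> e < i")
    case True
    then show ?thesis
      using anti[OF that] f_le[of i'] that by (simp add: f_def)
  next
    case False
    show ?thesis
    proof (cases "i' = i")
      case neq: False
      have "i' \<le> e \<Longrightarrow> P (Suc i') \<le> P (Suc i)" "i < e \<Longrightarrow> j \<le> P (Suc i)" "e < i' \<Longrightarrow> P i' < j"
        using anti[of "Suc i" "Suc i'"] gal[of "Suc i"] gal[of i'] that by auto
      then show ?thesis
        using False neq that by (auto simp: f_def)
    qed simp
  qed
  obtain mu where mu: "is_partition mu" and part_mu: "\<And>i. 1 \<le> i \<Longrightarrow> part mu i = f i"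
  proof -
    have "f i = 0" if "max e (length lam) < i" for i
      using that by (simp add: f_def P_def)
    then show ?thesis
      using partition_exists[of f "max e (length lam)"] f_anti that by blast
  qed
  define D where "D = diagram lam - diagram mu"
  have D_iff: "(i, k) \<in> D \<longleftrightarrow> i \<in> {a..e} \<and> k \<in> {f i<..P i}" for i k
    using a by (auto simp: D_def mem_diagram_iff part_mu P_def f_def split: if_splits)
  \<comment> \<open>The last condition says that \<open>(Suc i, Suc k)\<close> is outside the
    diagram of \<open>lam\<close>, so the strip is the part of the rim weakly below row
    \<open>a\<close> and weakly right of column \<open>j\<close>. In this form the absence of
    squares is immediate.\<close>
  have D_rim: "(i, k) \<in> D \<longleftrightarrow> a \<le> i \<and> j \<le> k \<and> k \<le> P i \<and> P (Suc i) \<le> k" for i k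
  proof (cases "a \<le> i")
    case True
    then have "i \<le> e \<longleftrightarrow> j \<le> P i" "Suc i \<le> e \<longleftrightarrow> j \<le> P (Suc i)"
      using gal[of i] gal[of "Suc i"] a by auto
    then show ?thesis
      using True j by (auto simp: D_iff f_def)
  qed (simp add: D_iff)
  have corner: "(e, j) \<in> D"
    using ae a gal[of e] gal[of "Suc e"] by (simp add: D_rim)
  let ?E = "{(x, y). x \<in> D \<and> y \<in> D \<and> adjacent x y}"
  \<comment> \<open>Walk down while the cell below is in the diagram, otherwise left. Each step
    decreases \<open>e + k - i\<close>, and the walk can only stop at the foot \<open>(e, j)\<close>
    of column \<open>j\<close>.\<close>
  have to_corner: "((i, k), (e, j)) \<in> ?E\<^sup>*" if "(i, k) \<in> D" for i k
    using that
  proof (induction "e + k - i" arbitrary: i k rule: less_induct)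
    case less
    have ik: "a \<le> i" "j \<le> k" "k \<le> P i" "P (Suc i) \<le> k" using less.prems by (auto simp: D_rim)
    have ie: "i \<le> e" using less.prems by (simp add: D_iff)
    consider "k \<le> P (Suc i)" | "P (Suc i) < k" "j < k" | "P (Suc i) < k" "k = j"
      using ik by linarith
    then show ?case
    proof cases
      case 1
      then have D': "(Suc i, k) \<in> D"
        using ik anti[of "Suc i" "Suc (Suc i)"] by (simp add: D_rim)
      then have "Suc i \<le> e" by (simp add: D_iff)
      then have "((Suc i, k), (e, j)) \<in> ?E\<^sup>*"
        using D' by (intro less.hyps) auto
      moreover have "((i, k), (Suc i, k)) \<in> ?E"
        using less.prems D' by (simp add: adjacent_def)
      ultimately show ?thesis by (rule converse_rtrancl_into_rtrancl[rotated])
    next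
      case 2
      then have D': "(i, k - 1) \<in> D"
        using ik by (auto simp: D_rim)
      then have "((i, k - 1), (e, j)) \<in> ?E\<^sup>*"
        using ie 2 by (intro less.hyps) auto
      moreover have "((i, k), (i, k - 1)) \<in> ?E"
        using less.prems D' 2 by (simp add: adjacent_def)
      ultimately show ?thesis by (rule converse_rtrancl_into_rtrancl[rotated])
    next
      case 3
      then have "i = e" using gal[of "Suc i"] ie by auto
      then show ?thesis using 3 by simp
    qed
  qed
  have "sym ?E" by (auto simp: sym_def adjacent_def)
  then have "sym (?E\<^sup>*)" by (rule sym_rtrancl)
  then have "cells_connected D"
    unfolding cells_connected_def
    by (auto dest!: to_corner) (meson rtrancl_trans symD)
  moreover have "\<not> has_square D"
    by (auto simp: has_square_def D_rim)
  moreover have "card D = t"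
  proof -
    \<comment> \<open>Row \<open>i < e\<close> of the strip has \<open>P i - P (Suc i) + 1\<close>
      cells and row \<open>e\<close> has \<open>P e - (j - 1)\<close>. The total is
      \<open>P a - a\<close> minus \<open>j - 1 - e\<close>, which is
      \<open>s - (s - t)\<close>.\<close>
    have tele: "(\<Sum>i\<in>{a..<x}. int (P i) - int (P (Suc i)) + 1) = int (P a) - int (P x) + int x - int a"
      if "a \<le> x" for x
      using that by (induction x rule: dec_induct) auto
    have "D = Sigma {a..e} (\<lambda>i. {f i<..P i})" using D_iff by auto
    then have "int (card D) = (\<Sum>i\<in>{a..e}. int (P i) - int (f i))"
      using f_le a by (simp add: of_nat_diff)
    also have "\<dots> = (\<Sum>i\<in>{a..<e}. int (P i) - int (f i)) + (int (P e) - int (f e))"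
      using ae by (simp add: atLeastLessThanSuc_atLeastAtMost[symmetric])
    also have "(\<Sum>i\<in>{a..<e}. int (P i) - int (f i)) = (\<Sum>i\<in>{a..<e}. int (P i) - int (P (Suc i)) + 1)"
    proof (rule sum.cong[OF refl])
      fix i assume i: "i \<in> {a..<e}"
      then have "j \<le> P (Suc i)" using gal[of "Suc i"] by auto
      then show "int (P i) - int (f i) = int (P i) - int (P (Suc i)) + 1"
        using i j by (auto simp: f_def)
    qed
    also have "\<dots> + (int (P e) - int (f e)) = int t"
      using tele[OF ae] j ae sa sj by (simp add: f_def e_def P_def)
    finally show ?thesis by simp
  qed
  moreover have "diagram mu \<subseteq> diagram lam"
    using f_le by (force simp: mem_diagram_iff part_mu P_def)
  ultimately have "removes_border_strip t lam mu"
    using lam mu by (simp add: removes_border_strip_def D_def)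
  with core show False by blast
qed

section \<open>Beta numbers, flush Maya diagrams of cores, self-conjugacy and rank\<close>

lemma beta_strictly_decreasing:
  assumes "is_partition lam" "length lam \<le> m"
  shows "sorted_wrt (>) (beta lam m)"
proof -
  have "part lam y + m - y < part lam x + m - x" if "1 \<le> x" "x < y" "y \<le> m" for x y
    using part_antimono[OF assms(1) that(1), of y] that by simp
  then show ?thesis
    unfolding beta_def by (auto simp: sorted_wrt_iff_nth_less simp del: upt_Suc)
qed

lemma distinct_beta:
  assumes "is_partition lam" "length lam \<le> m"
  shows "distinct (beta lam m)"
  using beta_strictly_decreasing[OF assms] strict_sorted_iff[of "rev (beta lam m)"]
  by (simp add: sorted_wrt_rev)

lemma mem_beta_iff:
  assumes "is_partition lam" "length lam \<le> m"
  shows "b \<in> set (beta lam m) \<longleftrightarrow> int b - int m \<in> beads lam"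
proof
  assume "b \<in> set (beta lam m)"
  then obtain j where "1 \<le> j" "j \<le> m" "b = part lam j + m - j"
    by (auto simp: beta_def)
  then show "int b - int m \<in> beads lam"
    by (force simp: beads_def of_nat_diff)
next
  assume "int b - int m \<in> beads lam"
  then obtain j where j: "1 \<le> j" "int b - int m = int (part lam j) - int j"
    by (auto simp: beads_def)
  \<comment> \<open>A row \<open>j > m\<close> has part 0, so its bead \<open>- j\<close> would make
    \<open>b\<close> negative.\<close>
  moreover have "j \<le> m"
  proof (rule ccontr)
    assume "\<not> j \<le> m"
    then show False using j assms(2) by simp
  qed
  ultimately show "b \<in> set (beta lam m)"
    by (auto simp: beta_def simp del: upt_Suc intro!: image_eqI[of _ _ j])
qed

text \<open>In one residue class the quotients of the beta numbers are closed downwards, so they are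
  exactly those below \<open>n_i\<close>. The bead \<open>s\<close> has beta number
  \<open>s + t * n\<close>, whose quotient is \<open>s div t + n\<close>; hence the threshold
  \<open>n_i - n\<close>. Positions below \<open>- (t * n)\<close> belong to empty rows and are
  always beads, in accordance with the threshold being at least \<open>- n\<close>.\<close>

lemma core_beads_iff:
  assumes "is_partition rho" "length rho \<le> t * n" "1 \<le> t"
    and closed: "\<And>s. s \<in> beads rho \<Longrightarrow> s - int t \<in> beads rho"
  shows "s \<in> beads rho \<longleftrightarrow>
    s div int t < int (n_residue t rho (t * n) (nat (s mod int t))) - int n"
proof -
  let ?m = "t * n"
  define i where "i = nat (s mod int t)"
  have it: "i < t" "int i = s mod int t"
    using assms(3) by (auto simp: i_def nat_less_iff)
  define Q where "Q = {q. t * q + i \<in> set (beta rho ?m)}"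
  have inj: "inj_on (\<lambda>q. t * q + i) Q" using assms(3) by (auto simp: inj_on_def)
  have im: "(\<lambda>q. t * q + i) ` Q = set (beta_residue t rho ?m i)"
  proof (intro equalityI subsetI)
    fix b assume "b \<in> set (beta_residue t rho ?m i)"
    then have "b \<in> set (beta rho ?m)" "b = t * (b div t) + i"
      by (auto simp: beta_residue_def)
    then show "b \<in> (\<lambda>q. t * q + i) ` Q" unfolding Q_def by (metis image_eqI mem_Collect_eq)
  qed (use it in \<open>auto simp: Q_def beta_residue_def\<close>)
  have fin: "finite Q"
    using finite_imageD[OF _ inj] im by simp
  have "distinct (beta_residue t rho ?m i)"
    unfolding beta_residue_def using distinct_beta[OF assms(1,2)] by simp
  then have cardQ: "card Q = n_residue t rho ?m i"
    using card_image[OF inj] im by (simp add: n_residue_def distinct_card)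
  have down: "q \<in> Q" if "Suc q \<in> Q" for q
  proof -
    have "int (t * Suc q + i) - int ?m - int t \<in> beads rho"
      using that unfolding Q_def mem_Collect_eq mem_beta_iff[OF assms(1,2)] by (rule closed)
    then show ?thesis
      unfolding Q_def mem_Collect_eq mem_beta_iff[OF assms(1,2)] by (simp add: algebra_simps)
  qed
  have down': "q \<in> Q" if "q' \<in> Q" "q \<le> q'" for q q'
    using that(2,1) by (induction rule: inc_induct) (auto intro: down)
  have Q_iff: "q \<in> Q \<longleftrightarrow> q < card Q" for q
  proof
    assume "q \<in> Q"
    then have "{..q} \<subseteq> Q" using down' by auto
    then show "q < card Q" using card_mono[OF fin, of "{..q}"] by simp
  next
    assume q: "q < card Q"
    show "q \<in> Q"
    proof (rule ccontr)
      assume "q \<notin> Q"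
      then have "Q \<subseteq> {..<q}" using down' by (metis lessThan_iff not_less subsetI)
      then show False using card_mono[of "{..<q}" Q] q by simp
    qed
  qed
  have s: "s = int t * (s div int t) + int i" using it by simp
  show ?thesis
  proof (cases "- int n \<le> s div int t")
    case True
    define q where "q = nat (s div int t + int n)"
    have q: "int q = s div int t + int n" using True by (simp add: q_def)
    have "int (t * q + i) - int ?m = s"
      using s by (simp add: q algebra_simps)
    then have "s \<in> beads rho \<longleftrightarrow> q \<in> Q"
      unfolding Q_def mem_Collect_eq mem_beta_iff[OF assms(1,2)] by simp
    then show ?thesis
      using Q_iff[of q] cardQ q by (simp add: i_def[symmetric]) linarith
  next
    case False
    then have "int t * (s div int t) \<le> int t * (- int n - 1)"
      using assms(3) by (intro mult_left_mono) auto
    moreover have "int t * (- int n - 1) = - int ?m - int t" by (simp add: algebra_simps)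
    ultimately have "s < - int ?m"
      using s it(1) by linarith
    then have "s \<in> beads rho"
    proof -
      have "0 < nat (- s)" "int (nat (- s)) = - s" "t * n < nat (- s)"
        using \<open>s < - int ?m\<close> by linarith+
      then show ?thesis
        using assms(2) unfolding beads_def by (intro CollectI exI[of _ "nat (- s)"]) simp
    qed
    then show ?thesis using False by simp
  qed
qed

text \<open>A bead \<open>part lam j - j\<close> is nonnegative exactly when row \<open>j\<close>
  meets the main diagonal, and these are the rows up to the rank.\<close>

lemma rank_eq_card_beads:
  assumes "is_partition lam"
  shows "partition_rank lam = card {s \<in> beads lam. 0 \<le> s}"
proof -
  let ?r = "partition_rank lam"
  have bound: "k \<le> length lam" if "k \<le> part lam k" for k
    using that by (cases "k \<le> length lam") auto
  have r: "?r \<le> part lam ?r"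
    unfolding partition_rank_def by (rule GreatestI_nat[of _ 0 "length lam"]) (use bound in auto)
  have le: "k \<le> ?r" if "k \<le> part lam k" for k
    unfolding partition_rank_def by (rule Greatest_le_nat[where b = "length lam"]) (use bound that in auto)
  have "{s \<in> beads lam. 0 \<le> s} = (\<lambda>j. int (part lam j) - int j) ` {1..?r}"
  proof (intro equalityI subsetI)
    fix s assume "s \<in> (\<lambda>j. int (part lam j) - int j) ` {1..?r}"
    then obtain j where j: "1 \<le> j" "j \<le> ?r" "s = int (part lam j) - int j" by auto
    then show "s \<in> {s \<in> beads lam. 0 \<le> s}"
      using part_antimono[OF assms j(1,2)] r by (auto simp: beads_def)
  next
    fix s assume "s \<in> {s \<in> beads lam. 0 \<le> s}"
    then show "s \<in> (\<lambda>j. int (part lam j) - int j) ` {1..?r}"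
      using le by (auto simp: beads_def)
  qed
  moreover have "inj_on (\<lambda>j. int (part lam j) - int j) {1..?r}"
    using bead_less[OF assms]
    by (intro linorder_inj_onI) (auto, metis less_irrefl)
  ultimately show ?thesis by (simp add: card_image)
qed

text \<open>Writing \<open>s = t * q + i\<close>, the reflected position \<open>- 1 - s\<close> is
  \<open>t * (- 1 - q) + (t - 1 - i)\<close>. So self-conjugacy compares residue class
  \<open>i\<close>, filled below \<open>N i\<close>, with the reflected complement of class
  \<open>t - 1 - i\<close>, which is filled below \<open>- N (t - 1 - i)\<close>.\<close>

lemma core_self_conjugate_iff:
  assumes "is_core_of t rho lam" "is_partition lam" "length lam \<le> t * n" "2 \<le> t"
  shows "self_conjugate rho \<longleftrightarrow>
    (\<forall>i<t. n_residue t lam (t * n) i + n_residue t lam (t * n) (t - 1 - i) = 2 * n)"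
proof -
  note inv = core_invariants[OF assms(1-3)]
  define N where "N i = int (n_residue t lam (t * n) i) - int n" for i
  have beads: "s \<in> beads rho \<longleftrightarrow> s div int t < N (nat (s mod int t))" for s
    unfolding N_def inv(3)[symmetric]
    by (rule core_beads_iff[OF inv(1,2)])
      (use beads_closed_if_no_border_strip[OF inv(1)] assms in \<open>auto simp: is_core_of_def\<close>)
  have refl_div: "(- 1 - (int t * q + int i)) div int t = - 1 - q" "(- 1 - (int t * q + int i)) mod int t = int (t - 1 - i)"
    "(int t * q + int i) div int t = q" "(int t * q + int i) mod int t = int i"
    if "i < t" for i q
  proof -
    have eq: "- 1 - (int t * q + int i) = int (t - 1 - i) + (- 1 - q) * int t"
      using that by (simp add: algebra_simps of_nat_diff)
    have "int (t - 1 - i) div int t = 0" using that by (intro div_pos_pos_trivial) auto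
    then show "(- 1 - (int t * q + int i)) div int t = - 1 - q" 
      unfolding eq using assms(4) by (subst div_mult_self1) auto
    show "(- 1 - (int t * q + int i)) mod int t = int (t - 1 - i)"
      unfolding eq mod_mult_self1 using that by (intro mod_pos_pos_trivial) auto
    show "(int t * q + int i) div int t = q" "(int t * q + int i) mod int t = int i"
      using that by auto
  qed
  have b1: "int t * q + int i \<in> beads rho \<longleftrightarrow> q < N i"
    and b2: "- 1 - (int t * q + int i) \<in> beads rho \<longleftrightarrow> - 1 - q < N (t - 1 - i)"
    if "i < t" for i q
    unfolding beads refl_div[OF that] nat_int by (rule refl)+
  \<comment> \<open>The instances \<open>N i\<close> and \<open>N i - 1\<close> are the first empty
    and the last filled position; together they pin down the threshold.\<close>
  have key: "(\<forall>q. q < N i \<longleftrightarrow> \<not> - 1 - q < N (t - 1 - i)) \<longleftrightarrow> N i = - N (t - 1 - i)" for i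
  proof
    assume "\<forall>q. q < N i \<longleftrightarrow> \<not> - 1 - q < N (t - 1 - i)"
    from this[rule_format, of "N i"] this[rule_format, of "N i - 1"]
    show "N i = - N (t - 1 - i)" by linarith
  qed auto
  have "self_conjugate rho \<longleftrightarrow> (\<forall>s. s \<in> beads rho \<longleftrightarrow> - 1 - s \<notin> beads rho)"
    by (rule self_conjugate_iff_beads[OF inv(1)])
  also have "\<dots> \<longleftrightarrow> (\<forall>i<t. \<forall>q. int t * q + int i \<in> beads rho \<longleftrightarrow> - 1 - (int t * q + int i) \<notin> beads rho)"
  proof (intro iffI, blast, rule allI)
    fix s assume *: "\<forall>i<t. \<forall>q. int t * q + int i \<in> beads rho \<longleftrightarrow> - 1 - (int t * q + int i) \<notin> beads rho"
    have "nat (s mod int t) < t" "s = int t * (s div int t) + int (nat (s mod int t))"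
      using assms(4) by (auto simp: nat_less_iff)
    then show "s \<in> beads rho \<longleftrightarrow> - 1 - s \<notin> beads rho" using * by metis
  qed
  also have "\<dots> \<longleftrightarrow> (\<forall>i<t. \<forall>q. q < N i \<longleftrightarrow> \<not> - 1 - q < N (t - 1 - i))"
    using b1 b2 by auto
  also have "\<dots> \<longleftrightarrow> (\<forall>i<t. N i = - N (t - 1 - i))"
    by (simp only: key)
  also have "\<dots> \<longleftrightarrow> (\<forall>i<t. n_residue t lam (t * n) i + n_residue t lam (t * n) (t - 1 - i) = 2 * n)"
    unfolding N_def by (rule all_cong1, rule imp_cong[OF refl]) linarith
  finally show ?thesis .
qed

text \<open>The rank counts nonnegative beads, that is, it is the sum of the positive parts of all
  \<open>N i\<close>. Since \<open>N (t - 1 - i) = - N i\<close>, a pair of residues contributes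
  \<open>\<bar>N i\<bar>\<close>, which has the parity of \<open>n_i + n\<close>, and a middle
  residue contributes 0.\<close>

lemma core_rank_parity:
  assumes "is_core_of t rho lam" "is_partition lam" "length lam \<le> t * n" "2 \<le> t"
    and sc: "self_conjugate rho"
  shows "even (partition_rank rho + (\<Sum>i = (t + 1) div 2..t - 1. n_residue t lam (t * n) i + n))"
proof -
  note inv = core_invariants[OF assms(1-3)]
  define N where "N i = int (n_residue t lam (t * n) i) - int n" for i
  have beads: "s \<in> beads rho \<longleftrightarrow> s div int t < N (nat (s mod int t))" for s
    unfolding N_def inv(3)[symmetric]
    by (rule core_beads_iff[OF inv(1,2)])
      (use beads_closed_if_no_border_strip[OF inv(1)] assms in \<open>auto simp: is_core_of_def\<close>)
  have sym: "N (t - 1 - i) = - N i" if "i < t" for i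
    using sc that unfolding core_self_conjugate_iff[OF assms(1-4)] N_def by fastforce
  let ?F = "\<lambda>(i, q). int t * q + int i"
  let ?S = "SIGMA i:{..<t}. {0..<N i}"
  have dm: "(int t * q + int i) div int t = q" "(int t * q + int i) mod int t = int i"
    if "i < t" for i q using that by auto
  have "{s \<in> beads rho. 0 \<le> s} = ?F ` ?S"
  proof (intro equalityI subsetI)
    fix s assume s: "s \<in> {s \<in> beads rho. 0 \<le> s}"
    have "nat (s mod int t) < t" "s = int t * (s div int t) + int (nat (s mod int t))"
      using assms(4) by (auto simp: nat_less_iff)
    moreover have "0 \<le> s div int t" using s assms(4) by (auto simp: pos_imp_zdiv_nonneg_iff)
    ultimately show "s \<in> ?F ` ?S"
      using s unfolding beads by (intro image_eqI[of _ _ "(nat (s mod int t), s div int t)"]) auto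
  qed (auto simp: beads dm)
  moreover have "inj_on ?F ?S"
  proof (rule inj_onI, clarsimp)
    fix i q i' q' assume "i < t" "i' < t" "int t * q + int i = int t * q' + int i'"
    then show "i = i' \<and> q = q'" using dm by (metis of_nat_eq_iff)
  qed
  ultimately have "partition_rank rho = card ?S"
    using rank_eq_card_beads[OF inv(1)] by (simp add: card_image)
  then have r: "partition_rank rho = (\<Sum>i<t. nat (N i))" by simp
  let ?lo = "{..<t div 2}" and ?mid = "{t div 2..<(t + 1) div 2}" and ?hi = "{(t + 1) div 2..t - 1}"
  have U: "{..<t} = (?lo \<union> ?mid) \<union> ?hi" using assms(4) by auto
  have "(\<Sum>i<t. nat (N i)) = (\<Sum>i\<in>?lo \<union> ?mid. nat (N i)) + (\<Sum>i\<in>?hi. nat (N i))"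
    unfolding U by (rule sum.union_disjoint) auto
  also have "(\<Sum>i\<in>?lo \<union> ?mid. nat (N i)) = (\<Sum>i\<in>?lo. nat (N i)) + (\<Sum>i\<in>?mid. nat (N i))"
    by (rule sum.union_disjoint) auto
  finally have split: "(\<Sum>i<t. nat (N i)) = (\<Sum>i\<in>?lo. nat (N i)) + (\<Sum>i\<in>?mid. nat (N i)) + (\<Sum>i\<in>?hi. nat (N i))" .
  have "nat (N i) = 0" if "i \<in> ?mid" for i
  proof -
    have "t - 1 - i = i" "i < t" using that by auto
    then show ?thesis using sym[of i] by simp
  qed
  then have mid: "(\<Sum>i\<in>?mid. nat (N i)) = 0" by simp
  have lo: "(\<Sum>i\<in>?lo. nat (N i)) = (\<Sum>i\<in>?hi. nat (- N i))"
    by (rule sum.reindex_bij_witness[of _ "\<lambda>i. t - 1 - i" "\<lambda>i. t - 1 - i"])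
      (use assms(4) sym in \<open>auto\<close>)
  have "partition_rank rho = (\<Sum>i\<in>?hi. nat \<bar>N i\<bar>)"
    unfolding r split mid lo add_0_right sum.distrib[symmetric] by (rule sum.cong) auto
  then have "partition_rank rho + (\<Sum>i\<in>?hi. n_residue t lam (t * n) i + n)
      = (\<Sum>i\<in>?hi. nat \<bar>N i\<bar> + (n_residue t lam (t * n) i + n))"
    by (simp add: sum.distrib)
  also have "even \<dots>"
  proof (rule dvd_sum)
    fix i
    have "even (\<bar>int a - int b\<bar> + int (a + b))" for a b
      by (auto simp: abs_if)
    then have "even (int (nat \<bar>N i\<bar> + (n_residue t lam (t * n) i + n)))"
      unfolding N_def by simp
    then show "even (nat \<bar>N i\<bar> + (n_residue t lam (t * n) i + n))" by (simp only: even_of_nat_iff)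
  qed
  finally show ?thesis .
qed

section \<open>Quotients and alternants\<close>

text \<open>The entry \<open>a k\<close> crosses the \<open>k\<close> lists \<open>D 0\<close>, ...,
  \<open>D (k - 1)\<close>, each of length \<open>l\<close>.\<close>

lemma swaps_interleave:
  assumes "\<And>i. i < k \<Longrightarrow> length (D i) = l"
  shows "swaps ((k choose 2) * l) (map a [0..<k] @ concat (map D [0..<k]))
    (concat (map (\<lambda>i. a i # D i) [0..<k]))"
  using assms
proof (induction k)
  case (Suc k)
  let ?A = "map a [0..<k]" and ?D = "concat (map D [0..<k])"
  have "length ?D = k * l"
  proof -
    have *: "map (\<lambda>i. length (D i)) [0..<k] = map (\<lambda>i. l) [0..<k]"
      using Suc.prems by (intro map_cong) auto
    show ?thesis by (simp add: length_concat comp_def sum_list_triv *)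
  qed
  then have "swaps (k * l) (?A @ (a k # ?D) @ D k) (?A @ (?D @ [a k]) @ D k)"
    using swaps_context[OF swaps_Cons[of ?D "a k"], of ?A "D k"] by simp
  moreover have "swaps ((k choose 2) * l) ((?A @ ?D) @ (a k # D k))
      (concat (map (\<lambda>i. a i # D i) [0..<k]) @ (a k # D k))"
    using Suc by (intro swaps_suffix) simp
  ultimately have "swaps (k * l + (k choose 2) * l) (?A @ (a k # ?D) @ D k)
      (concat (map (\<lambda>i. a i # D i) [0..<k]) @ (a k # D k))"
    using swaps_trans by fastforce
  moreover have "(Suc k choose 2) = k + (k choose 2)"
    by (simp add: numeral_2_eq_2)
  ultimately show ?case by (simp add: algebra_simps)
qed (simp add: swaps_refl numeral_2_eq_2)

text \<open>Layers are treated from outside in: list \<open>T - 1 - q\<close> is reversed, which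
  costs the binomial coefficient, and then moved left past the lists strictly between
  \<open>q\<close> and \<open>T - 1 - q\<close>. The parameter \<open>p\<close> counts layers
  already stripped, so the induction runs outwards from the middle.\<close>

lemma swaps_fold:
  fixes C :: "nat \<Rightarrow> 'a list" and T :: nat
  defines "F \<equiv> \<lambda>q. if 2 * q + 1 = T then C q else C q @ rev (C (T - 1 - q))"
  assumes "p \<le> T div 2"
  shows "swaps (\<Sum>q\<in>{p..<T div 2}. (length (C (T - 1 - q)) choose 2)
        + length (C (T - 1 - q)) * (\<Sum>u\<in>{Suc q..<T - 1 - q}. length (C u)))
      (concat (map C [p..<T - p])) (concat (map F [p..<(T + 1) div 2]))"
  using assms(2)
proof (induction rule: inc_induct)
  case base
  show ?case
  proof (cases "even T")
    case True
    then have "T - T div 2 = T div 2" "(T + 1) div 2 = T div 2" by presburger+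
    then show ?thesis by (simp add: swaps_refl)
  next
    case False
    then have "T - T div 2 = Suc (T div 2)" "(T + 1) div 2 = Suc (T div 2)" "2 * (T div 2) + 1 = T"
      by presburger+
    then show ?thesis by (simp add: swaps_refl F_def)
  qed
next
  case (step p)
  define B where "B = C (T - 1 - p)"
  define M where "M = concat (map C [Suc p..<T - Suc p])"
  have pT: "p < T - p" "Suc p \<le> T - Suc p" "T - 1 - p = T - Suc p" "T - p = Suc (T - Suc p)"
    using step.hyps by auto
  have "[p..<T - p] = p # [Suc p..<T - Suc p] @ [T - Suc p]"
    using pT by (simp add: upt_conv_Cons)
  then have L: "concat (map C [p..<T - p]) = C p @ M @ B"
    by (simp add: M_def B_def)
  have lenM: "length M = (\<Sum>u\<in>{Suc p..<T - 1 - p}. length (C u))"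
    by (simp add: M_def length_concat comp_def sum_list_distinct_conv_sum_set)
  have s1: "swaps (length B choose 2) (C p @ M @ B) (C p @ M @ rev B)"
    using swaps_prefix[OF swaps_rev[of B], of "C p @ M"] by simp
  have s2: "swaps (length B * length M) (C p @ M @ rev B) (C p @ rev B @ M)"
    using swaps_prefix[OF swaps_append[of M "rev B"], of "C p"] by (simp add: mult.commute)
  note s3 = swaps_prefix[OF step.IH, of "C p @ rev B", folded M_def, unfolded append_assoc]
  have sw: "swaps ((length B choose 2) + length B * length M + (\<Sum>q\<in>{Suc p..<T div 2}. (length (C (T - 1 - q)) choose 2)
        + length (C (T - 1 - q)) * (\<Sum>u\<in>{Suc q..<T - 1 - q}. length (C u))))
      (C p @ M @ B) (C p @ rev B @ concat (map F [Suc p..<(T + 1) div 2]))"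
    by (rule swaps_trans[OF s3 swaps_trans[OF s2 s1]])
  have "2 * p + 1 \<noteq> T" using step.hyps by presburger
  then have R: "concat (map F [p..<(T + 1) div 2]) = C p @ rev B @ concat (map F [Suc p..<(T + 1) div 2])"
    using step.hyps by (simp add: upt_conv_Cons F_def B_def)
  show ?case
    using sw unfolding L R sum.atLeast_Suc_lessThan[OF step.hyps(2)] lenM B_def .
qed

lemma filter_residue_upt:
  assumes "i < t"
  shows "filter (\<lambda>b. b mod t = i) [0..<t * n] = map (\<lambda>q. t * q + i) [0..<n]"
proof (induction n)
  case (Suc n)
  have "[0..<t * Suc n] = [0..<t * n] @ map (\<lambda>b. b + t * n) [0..<t]"
    using upt_add_eq_append[of 0 "t * n" t] by (simp add: map_add_upt add.commute)
  moreover have "filter (\<lambda>b. (b + t * n) mod t = i) [0..<t] = filter (\<lambda>b. b = i) [0..<t]"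
    by (rule filter_cong) auto
  moreover have "filter (\<lambda>b. b = i) [0..<k] = (if i < k then [i] else [])" for k
    by (induction k) auto
  ultimately show ?case
    using Suc assms by (simp add: filter_map comp_def add.commute)
qed simp

lemma beta_Nil: "beta [] m = rev [0..<m]"
  unfolding beta_def by (rule nth_equalityI) (auto simp: part_def rev_nth simp del: upt_Suc)

lemma beta_residue_Nil:
  assumes "i < t"
  shows "beta_residue t [] (t * n) i = rev (map (\<lambda>q. t * q + i) [0..<n])"
  unfolding beta_residue_def beta_Nil
  by (simp add: rev_filter[symmetric] filter_residue_upt[OF assms])

text \<open>This sorts the columns of the denominator, where the beta set is
  \<open>t * n - 1\<close>, ..., \<open>0\<close>. Passing from \<open>n\<close> to
  \<open>Suc n\<close> puts \<open>t\<close> new entries in front; they are reversed, and after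
  sorting the rest each is moved to the head of its residue class.\<close>

lemma swaps_beta_Nil:
  "swaps ((t choose 2) * (Suc n choose 2)) (beta [] (t * n))
    (concat (map (beta_residue t [] (t * n)) [0..<t]))"
proof -
  let ?D = "\<lambda>n i. rev (map (\<lambda>q. t * q + i) [0..<n])"
  have "swaps ((t choose 2) * (Suc n choose 2)) (rev [0..<t * n]) (concat (map (?D n) [0..<t]))"
  proof (induction n)
    case 0
    have *: "concat (map (\<lambda>i. []) [0..<t]) = ([] :: nat list)" by (induction t) auto
    show ?case by (simp add: swaps_refl numeral_2_eq_2 *)
  next
    case (Suc n)
    let ?a = "\<lambda>i. t * n + i"
    have "map ?a [0..<t] = [t * n..<t * Suc n]"
      using map_add_upt[of "t * n" t] by (simp add: add.commute)
    moreover have "[0..<t * Suc n] = [0..<t * n] @ [t * n..<t * Suc n]"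
      using upt_add_eq_append[of 0 "t * n" t] by (simp add: add.commute)
    ultimately have L: "rev [0..<t * Suc n] = rev (map ?a [0..<t]) @ rev [0..<t * n]"
      by simp
    have "swaps (t choose 2) (rev (map ?a [0..<t]) @ rev [0..<t * n]) (map ?a [0..<t] @ rev [0..<t * n])"
      using swaps_suffix[OF swaps_rev[of "rev (map ?a [0..<t])"]] by simp
    moreover note swaps_prefix[OF Suc.IH, of "map ?a [0..<t]"]
    moreover have "swaps ((t choose 2) * n) (map ?a [0..<t] @ concat (map (?D n) [0..<t]))
        (concat (map (\<lambda>i. ?a i # ?D n i) [0..<t]))"
      by (rule swaps_interleave) simp
    ultimately have "swaps ((t choose 2) + (t choose 2) * (Suc n choose 2) + (t choose 2) * n)
        (rev [0..<t * Suc n]) (concat (map (\<lambda>i. ?a i # ?D n i) [0..<t]))"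
      unfolding L using swaps_trans by blast
    moreover have "(t choose 2) + (t choose 2) * (Suc n choose 2) + (t choose 2) * n
        = (t choose 2) * (Suc (Suc n) choose 2)"
      by (simp add: numeral_2_eq_2 algebra_simps)
    ultimately show ?case by simp
  qed
  moreover have "map (beta_residue t [] (t * n)) [0..<t] = map (?D n) [0..<t]"
    by (rule map_cong) (auto simp: beta_residue_Nil)
  ultimately show ?thesis by (simp only: beta_Nil)
qed

section \<open>Quotient parts and alternants in terms of beta numbers\<close>

lemma beta_residue_strictly_decreasing:
  assumes "is_partition lam" "length lam \<le> m"
  shows "sorted_wrt (>) (beta_residue t lam m i)"
  unfolding beta_residue_def using beta_strictly_decreasing[OF assms] by (rule sorted_wrt_filter)

text \<open>Within one residue class the quotients by \<open>t\<close> decrease strictly, so the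
  entry with \<open>x\<close> successors has quotient at least \<open>x\<close>. Hence the natural
  subtraction in \<open>t_quotient\<close> never truncates.\<close>

lemma n_residue_le_quotient:
  assumes "is_partition lam" "length lam \<le> m" "j < n_residue t lam m i"
  shows "n_residue t lam m i \<le> beta_residue t lam m i ! j div t + Suc j"
proof -
  let ?C = "beta_residue t lam m i"
  have "n_residue t lam m i - Suc k \<le> ?C ! k div t" if "k < n_residue t lam m i" for k
    using less_imp_le[OF that]
  proof (induction "n_residue t lam m i - Suc k" arbitrary: k)
    case (Suc x)
    then have k: "Suc k < n_residue t lam m i" by simp
    have x: "x = n_residue t lam m i - Suc (Suc k)" using Suc(2) by linarith
    have "x \<le> ?C ! Suc k div t" using Suc(1)[OF x] k x by simp
    moreover have "?C ! Suc k < ?C ! k"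
      using beta_residue_strictly_decreasing[OF assms(1,2)] k
      by (auto simp: sorted_wrt_iff_nth_less n_residue_def)
    moreover have "?C ! Suc k \<in> set ?C" "?C ! k \<in> set ?C"
      using k by (auto simp: n_residue_def)
    then have "?C ! Suc k mod t = i" "?C ! k mod t = i"
      by (auto simp: beta_residue_def)
    ultimately have "?C ! Suc k div t < ?C ! k div t"
      by (metis div_le_mono div_mod_decomp le_neq_implies_less less_imp_le nat_neq_iff)
    then show ?case using Suc(2) \<open>x \<le> _\<close> by linarith
  qed simp
  from this[OF assms(3)] show ?thesis by simp
qed

lemma part_t_quotient:
  assumes "is_partition lam" "length lam \<le> m" "j < n_residue t lam m i"
  shows "int (part (t_quotient t lam m i) (Suc j)) =
    int (beta_residue t lam m i ! j div t) + int (Suc j) - int (n_residue t lam m i)"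
  using n_residue_le_quotient[OF assms] assms(3)
  by (simp add: part_def t_quotient_def of_nat_diff del: upt_Suc)

lemma part_t_quotient_Nil:
  assumes "i < t"
  shows "part (t_quotient t [] (t * n) i) j = 0"
proof (cases "1 \<le> j \<and> j \<le> n")
  case True
  then obtain k where k: "j = Suc k" "k < n" by (cases j) auto
  have "n_residue t [] (t * n) i = n"
    by (simp add: n_residue_def beta_residue_Nil[OF assms])
  then have "int (part (t_quotient t [] (t * n) i) j) = 0"
    using part_t_quotient[of "[]" "t * n" k t i] k assms
    by (simp add: is_partition_def beta_residue_Nil[OF assms] rev_nth of_nat_diff)
  then show ?thesis by simp
next
  case False
  then show ?thesis
    by (auto simp: part_def t_quotient_def n_residue_def beta_residue_Nil[OF assms])
qed

lemma mu3_Nil: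
  assumes "p < t"
  shows "mu3 t n [] p = (\<lambda>_. 0)"
  using assms by (auto simp: mu3_def Let_def part_t_quotient_Nil)

lemma schur_alternant_eq_ldet:
  "schur_alternant mu ys = ldet (\<lambda>y e. y powi e) ys
    (map (\<lambda>j. mu (Suc j) + int (length ys) - int (Suc j)) [0..<length ys])"
  unfolding schur_alternant_def ldet_def Let_def
  by (rule arg_cong[where f = det], rule eq_matI) auto

lemma so_alternant_eq_ldet:
  "so_alternant mu ys = ldet (\<lambda>y e. y powi (e + 1) - y powi (- e)) ys
    (map (\<lambda>j. mu (Suc j) + int (length ys) - int (Suc j)) [0..<length ys])"
  unfolding so_alternant_def ldet_def Let_def
  by (rule arg_cong[where f = det], rule eq_matI) auto

text \<open>Pulling \<open>y powi K\<close> out of each row costs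
  \<open>prod_list ys powi K = 1\<close>. This absorbs the leading summand of \<open>mu3\<close>,
  the first part of the opposite quotient component.\<close>

lemma ldet_powi_shift:
  fixes ys :: "'a::field list"
  assumes "0 \<notin> set ys" "prod_list ys = 1" "length ys = length E"
  shows "ldet (\<lambda>y e. y powi e) ys (map ((+) K) E) = ldet (\<lambda>y e. y powi e) ys E"
proof -
  have pl: "prod_list (map (\<lambda>y. y powi K) L) = prod_list L powi K" for L :: "'a list"
    by (induction L) (auto simp: power_int_mult_distrib)
  have "ldet (\<lambda>y e. y powi e) ys (map ((+) K) E) = ldet (\<lambda>y e. y powi K * 1 * y powi e) ys E"
    unfolding ldet_map[of "\<lambda>y e. y powi e" "\<lambda>y. y" ys "(+) K" E, unfolded list.map_ident]
  proof (rule ldet_cong)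
    fix y e assume "y \<in> set ys"
    then have "y \<noteq> 0" using assms(1) by auto
    then show "y powi (K + e) = y powi K * 1 * y powi e" by (simp add: power_int_add)
  qed
  also have "\<dots> = ldet (\<lambda>y e. y powi e) ys E"
    unfolding ldet_scale[OF assms(3)] by (simp add: pl assms(2) map_replicate_const)
  finally show ?thesis .
qed

text \<open>The permutation of the statement acts on positions from 1, lists are indexed from 0.
  Keeping \<open>\<sigma>\<close> itself spares transporting its sign to a shifted
  permutation.\<close>

lemma ldet_permute_atLeast1:
  fixes f :: "'r \<Rightarrow> 'c \<Rightarrow> 'a::idom"
  assumes \<sigma>: "\<sigma> permutes {1..length C}" and len: "length R = length C"
  shows "ldet f R (map (\<lambda>j. C ! (\<sigma> j - 1)) [1..<Suc (length C)]) = of_int (sign \<sigma>) * ldet f R C"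
proof -
  let ?m = "length C"
  \<comment> \<open>Bordering by a fixed corner entry turns the index set \<open>{1..m}\<close> into \<open>{..<Suc m}\<close>.\<close>
  define g where "g r c = (case (r, c) of (Some r, Some c) \<Rightarrow> f r c | (None, None) \<Rightarrow> 1 | _ \<Rightarrow> 0)"
    for r c
  let ?R = "None # map Some R" and ?C = "None # map Some C"
  have border: "ldet g ?R (None # map Some D) = ldet f R D" if "length D = ?m" for D
  proof -
    have "ldet g ([None] @ map Some R) ([None] @ map Some D) = ldet g [None] [None] * ldet g (map Some R) (map Some D)"
      by (rule ldet_append) (use len that in \<open>auto simp: g_def\<close>)
    moreover have "ldet g [None] [None] = 1"
      unfolding ldet_def by (subst det_single) (auto simp: g_def)
    moreover have "ldet g (map Some R) (map Some D) = ldet f R D"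
      unfolding ldet_map by (simp add: g_def)
    ultimately show ?thesis by simp
  qed
  have "\<sigma> permutes {..<length ?C}"
    by (rule permutes_subset[OF \<sigma>]) auto
  from ldet_permute[OF this, of ?R g] len
  have "ldet g ?R (map (\<lambda>j. ?C ! \<sigma> j) [0..<length ?C]) = of_int (sign \<sigma>) * ldet g ?R ?C"
    by simp
  moreover have "map (\<lambda>j. ?C ! \<sigma> j) [0..<length ?C] = None # map Some (map (\<lambda>j. C ! (\<sigma> j - 1)) [1..<Suc ?m])"
  proof -
    have "[0..<length ?C] = 0 # [1..<Suc ?m]" by (simp add: upt_conv_Cons del: upt_Suc)
    moreover have "\<sigma> 0 = 0" using \<sigma> by (simp add: permutes_def)
    moreover have "?C ! \<sigma> j = Some (C ! (\<sigma> j - 1))" if "j \<in> {1..?m}" for j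
    proof -
      have "\<sigma> j \<in> {1..?m}" using permutes_in_image[OF \<sigma>] that by simp
      then show ?thesis by (auto simp: nth_Cons')
    qed
    ultimately show ?thesis by (auto simp del: upt_Suc)
  qed
  moreover have "length (map (\<lambda>j. C ! (\<sigma> j - 1)) [1..<Suc ?m]) = ?m" by (simp del: upt_Suc)
  ultimately show ?thesis using border[of C] by (simp only: border)
qed

text \<open>Here \<open>a q\<close> stands for \<open>n_residue\<close> at \<open>t - 1 - q\<close>.
  The summands are the folding swaps of \<open>lam\<close>, the sorting and folding swaps of the
  empty partition, the block signs, and \<open>so_epsilon\<close> up to sign. Since
  \<open>x + (x choose 2) = (Suc x choose 2)\<close>, the block signs complete the binomials of the
  folding swaps and these double up with \<open>so_epsilon\<close>. Two even terms remain:
  \<open>(t choose 2) + t div 2\<close>, and the sum of \<open>(a q + n) * d q\<close> plus the rank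
  term, where \<open>d q\<close> has the parity of \<open>t\<close>.\<close>

lemma sign_parity:
  fixes a :: "nat \<Rightarrow> nat" and t n r :: nat
  assumes "odd t \<Longrightarrow> even (r + (\<Sum>q<t div 2. a q + n))"
  shows "even ((\<Sum>q<t div 2. (a q choose 2) + a q * (n * (t - 2 - 2 * q)))
     + ((t choose 2) * (Suc n choose 2) + (\<Sum>q<t div 2. (n choose 2) + n * (n * (t - 2 - 2 * q))))
     + (\<Sum>q<t div 2. a q + n)
     + ((\<Sum>q<t div 2. Suc (a q) choose 2) + (if odd t then n * r else 0)))"
proof -
  have S: "(Suc x choose 2) = x + (x choose 2)" for x by (simp add: numeral_2_eq_2)
  define d where "d q = t - 2 - 2 * q" for q
  let ?E = "(\<Sum>q<t div 2. (a q + n) * d q)"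
  have "(\<Sum>q<t div 2. (a q choose 2) + a q * (n * d q)) + (\<Sum>q<t div 2. (n choose 2) + n * (n * d q))
      + (\<Sum>q<t div 2. a q + n)
    = (\<Sum>q<t div 2. (Suc (a q) choose 2) + (Suc n choose 2) + n * ((a q + n) * d q))"
    unfolding sum.distrib[symmetric] S by (rule sum.cong) (simp_all add: algebra_simps)
  also have "\<dots> = (\<Sum>q<t div 2. Suc (a q) choose 2) + t div 2 * (Suc n choose 2) + n * ?E"
    by (simp add: sum.distrib sum_distrib_left)
  finally have eq: "(\<Sum>q<t div 2. (a q choose 2) + a q * (n * d q))
     + ((t choose 2) * (Suc n choose 2) + (\<Sum>q<t div 2. (n choose 2) + n * (n * d q)))
     + (\<Sum>q<t div 2. a q + n)
     + ((\<Sum>q<t div 2. Suc (a q) choose 2) + (if odd t then n * r else 0))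
    = 2 * (\<Sum>q<t div 2. Suc (a q) choose 2) + (Suc n choose 2) * ((t choose 2) + t div 2)
      + n * (?E + (if odd t then r else 0))"
    by (simp add: distrib_left distrib_right mult.commute)
  have h1: "even ((t choose 2) + t div 2)"
  proof (cases "even t")
    case True
    then obtain u where u: "t = 2 * u" by blast
    have "(t choose 2) = u * (2 * u - 1)" by (simp add: choose_two u)
    then show ?thesis by (cases u) (auto simp: u binomial_eq_0)
  next
    case False
    then obtain u where u: "t = 2 * u + 1" using oddE by blast
    have "(t choose 2) = (2 * u + 1) * u" by (simp add: choose_two u)
    then show ?thesis by (auto simp: u)
  qed
  have h2: "even (?E + (if odd t then r else 0))"
  proof (cases "even t")
    case True
    then have "even (d q)" for q by (simp add: d_def)
    then show ?thesis using True by (auto intro!: dvd_sum)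
  next
    case False
    have "even (?E + (\<Sum>q<t div 2. a q + n))"
      unfolding sum.distrib[symmetric]
    proof (rule dvd_sum)
      fix q assume "q \<in> {..<t div 2}"
      then have "2 + 2 * q \<le> t" by auto
      then have "odd (d q)" using False by (simp add: d_def)
      then show "even ((a q + n) * d q + (a q + n))" by simp
    qed
    then show ?thesis using assms[OF False] False by (auto simp: even_add)
  qed
  show ?thesis
    unfolding d_def[symmetric] eq
    by (rule dvd_add[OF dvd_add[OF dvd_triv_left dvd_mult[OF h1]] dvd_mult[OF h2]])
qed

section \<open>Twisted variables\<close>

lemma set_folded_blocks:
  fixes t :: nat
  assumes "2 \<le> t"
  shows "(\<Union>p\<in>{..<(t + 1) div 2}. {p + 1, t - p}) = {1..t}"
proof (intro equalityI subsetI)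
  fix q assume q: "q \<in> {1..t}"
  show "q \<in> (\<Union>p\<in>{..<(t + 1) div 2}. {p + 1, t - p})"
  proof (cases "q - 1 < (t + 1) div 2")
    case True
    then show ?thesis using q by (intro UN_I[of "q - 1"]) auto
  next
    case False
    then show ?thesis using q by (intro UN_I[of "t - q"]) auto
  qed
qed (use assms in auto)

locale twisted_variables =
  fixes t n :: nat and \<omega> :: "'a::field_char_0" and X :: "'a list"
  assumes t: "2 \<le> t" and root: "primitive_root_of_unity t \<omega>"
    and length_X: "length X = n" and nonzero: "0 \<notin> set X"
begin

abbreviation Xt :: "'a list" where
  "Xt \<equiv> map (\<lambda>x. x ^ t) X"

abbreviation Z :: "'a list" where
  "Z \<equiv> map (\<lambda>x. x ^ t) X @ map (\<lambda>x. inverse x ^ t) X"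

text \<open>Row labels are pairs of a frequency \<open>q \<in> {1..t}\<close> and a variable index; the frequencies \<open>p + 1\<close>
  and \<open>t - p\<close> meet the same two residues, and coincide for the middle residue.\<close>

definition row_block :: "nat \<Rightarrow> (nat \<times> nat) list" where
  "row_block p = (if 2 * p + 1 = t then map (Pair (p + 1)) [0..<n]
     else map (Pair (p + 1)) [0..<n] @ map (Pair (t - p)) [0..<n])"

definition rows :: "(nat \<times> nat) list" where
  "rows = concat (map row_block [0..<(t + 1) div 2])"

text \<open>The Fourier coefficient at frequency \<open>q = fst r\<close>, with respect to
  \<open>k\<close>, of \<open>y powi (c + 1) - y powi (- c)\<close> at
  \<open>y = \<omega> ^ k * x\<close>: the first power has frequency \<open>c + 1\<close>, the
  second \<open>- c\<close>, modulo \<open>t\<close>. With \<open>q\<close> in \<open>{1..t}\<close>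
  the two natural subtractions give genuine residues. Both powers survive together only if
  \<open>2 * q = t + 1\<close>.\<close>

definition entry :: "nat \<times> nat \<Rightarrow> nat \<Rightarrow> 'a" where
  "entry r c = (if c mod t = fst r - 1 then (X ! snd r) powi (int c + 1) else 0)
     - (if c mod t = t - fst r then (X ! snd r) powi (- int c) else 0)"

text \<open>The Kronecker product of the discrete Fourier matrix of order \<open>t\<close> with the
  identity of order \<open>n\<close>, up to the order of rows and columns.\<close>

definition fourier :: "nat \<times> nat \<Rightarrow> nat \<times> nat \<Rightarrow> 'a" where
  "fourier s r = of_bool (snd s = snd r) * \<omega> ^ (fst s * fst r)"

lemma nth_X_nonzero: "i < n \<Longrightarrow> X ! i \<noteq> 0"
  using nonzero length_X by (metis nth_mem)

lemma root_power: "\<omega> ^ t = 1" "\<omega> \<noteq> 0"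
proof -
  show "\<omega> ^ t = 1" using root by (simp add: primitive_root_of_unity_def)
  then show "\<omega> \<noteq> 0" using t by (auto simp: power_0_left split: if_splits)
qed

lemma root_power_cong: "a mod t = b mod t \<Longrightarrow> \<omega> ^ a = \<omega> ^ b"
proof -
  have "\<omega> ^ a = \<omega> ^ (a mod t)" for a
    using root_power(1) by (metis div_mult_mod_eq mult.commute mult_1 power_add power_mult power_one)
  then show "a mod t = b mod t \<Longrightarrow> \<omega> ^ a = \<omega> ^ b" by metis
qed

lemma root_power_inject:
  assumes "a < t" "b < t" "\<omega> ^ a = \<omega> ^ b"
  shows "a = b"
proof -
  have *: "b \<le> a" if "a < t" "b < t" "\<omega> ^ a = \<omega> ^ b" for a b
  proof (rule ccontr)
    assume "\<not> b \<le> a"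
    then have "\<omega> ^ b = \<omega> ^ a * \<omega> ^ (b - a)" by (simp flip: power_add)
    then have "\<omega> ^ (b - a) = 1" using that root_power(2) by simp
    then show False
      using root that \<open>\<not> b \<le> a\<close> by (auto simp: primitive_root_of_unity_def)
  qed
  show ?thesis using *[of a b] *[of b a] assms by simp
qed

lemma length_row_block: "length (row_block p) = (if 2 * p + 1 = t then n else 2 * n)"
  by (simp add: row_block_def)

lemma set_row_block: "set (row_block p) = {p + 1, t - p} \<times> {..<n}"
  by (auto simp: row_block_def)

lemma set_rows: "set rows = {1..t} \<times> {..<n}"
proof -
  have "set rows = (\<Union>p\<in>{..<(t + 1) div 2}. {p + 1, t - p}) \<times> {..<n}"
    unfolding rows_def by (auto simp: set_row_block)
  then show ?thesis unfolding set_folded_blocks[OF t] .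
qed

lemma distinct_rows: "distinct rows"
proof -
  have "distinct (concat (map row_block [0..<k]))" if "k \<le> (t + 1) div 2" for k
    using that
  proof (induction k)
    case (Suc k)
    have "distinct (row_block k)"
      using Suc.prems by (auto simp: row_block_def distinct_map inj_on_def)
    moreover have "set (concat (map row_block [0..<k])) \<inter> set (row_block k) = {}"
      using Suc.prems by (auto simp: set_row_block)
    ultimately show ?case using Suc by auto
  qed simp
  then show ?thesis by (simp add: rows_def)
qed

lemma length_rows: "length rows = t * n"
  using distinct_card[OF distinct_rows] by (simp add: set_rows)

lemma twisted_eq: "twisted t \<omega> X = map (\<lambda>s. \<omega> ^ fst s * X ! snd s) (List.product [0..<t] [0..<n])"
proof -
  have "map (\<lambda>x. \<omega> ^ k * x) X = map (\<lambda>i. \<omega> ^ k * X ! i) [0..<n]" for k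
    by (rule nth_equalityI) (auto simp: length_X)
  then show ?thesis
    by (simp add: twisted_def product_concat_map map_concat comp_def)
qed

lemma fourier_entry:
  assumes "s \<in> {..<t} \<times> {..<n}"
  shows "(\<Sum>r\<leftarrow>rows. fourier s r * entry r c) =
    (\<omega> ^ fst s * X ! snd s) powi (int c + 1) - (\<omega> ^ fst s * X ! snd s) powi (- int c)"
proof -
  obtain k i where s: "s = (k, i)" "k < t" "i < n" using assms by (cases s) auto
  let ?x = "X ! i" and ?p = "c mod t"
  have p: "?p < t" using t by simp
  have "(\<Sum>r\<leftarrow>rows. fourier s r * entry r c) = (\<Sum>r\<in>{1..t} \<times> {..<n}. fourier s r * entry r c)"
    using sum_list_distinct_conv_sum_set[OF distinct_rows] by (simp add: set_rows)
  also have "\<dots> = (\<Sum>q\<in>{1..t}. \<Sum>i'\<in>{..<n}. fourier s (q, i') * entry (q, i') c)"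
    by (simp add: sum.cartesian_product)
  also have "\<dots> = (\<Sum>q\<in>{1..t}. \<omega> ^ (k * q) * entry (q, i) c)"
  proof (rule sum.cong[OF refl])
    fix q
    have "(\<Sum>i'\<in>{..<n}. fourier s (q, i') * entry (q, i') c)
        = (\<Sum>i'\<in>{..<n}. if i' = i then \<omega> ^ (k * q) * entry (q, i') c else 0)"
      by (rule sum.cong) (auto simp: fourier_def s)
    then show "(\<Sum>i'\<in>{..<n}. fourier s (q, i') * entry (q, i') c) = \<omega> ^ (k * q) * entry (q, i) c"
      using s by simp
  qed
  also have "\<dots> = (\<Sum>q\<in>{1..t}. (if q = ?p + 1 then \<omega> ^ (k * q) * ?x powi (int c + 1) else 0)
      - (if q = t - ?p then \<omega> ^ (k * q) * ?x powi (- int c) else 0))"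
  proof (rule sum.cong[OF refl])
    fix q assume "q \<in> {1..t}"
    then have "?p = q - 1 \<longleftrightarrow> q = ?p + 1" "?p = t - q \<longleftrightarrow> q = t - ?p" using p by auto
    then show "\<omega> ^ (k * q) * entry (q, i) c = (if q = ?p + 1 then \<omega> ^ (k * q) * ?x powi (int c + 1) else 0)
      - (if q = t - ?p then \<omega> ^ (k * q) * ?x powi (- int c) else 0)"
      by (simp add: entry_def right_diff_distrib)
  qed
  also have "\<dots> = \<omega> ^ (k * (?p + 1)) * ?x powi (int c + 1) - \<omega> ^ (k * (t - ?p)) * ?x powi (- int c)"
    using p by (simp add: sum_subtractf)
  also have "\<omega> ^ (k * (?p + 1)) = (\<omega> ^ k) powi (int c + 1)"
  proof -
    have "\<omega> ^ (k * (?p + 1)) = \<omega> ^ (k * (c + 1))"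
      by (rule root_power_cong) (metis mod_add_left_eq mod_mult_right_eq)
    also have "\<dots> = (\<omega> ^ k) ^ (c + 1)" by (rule power_mult)
    also have "\<dots> = (\<omega> ^ k) powi int (c + 1)" by (simp only: power_int_of_nat)
    finally show ?thesis by (simp add: add.commute)
  qed
  also have "\<omega> ^ (k * (t - ?p)) = (\<omega> ^ k) powi (- int c)"
  proof -
    \<comment> \<open>The frequency \<open>t - c mod t\<close> represents \<open>- c\<close> modulo
      \<open>t\<close>.\<close>
    have "c + (t - ?p) = t * (c div t + 1)"
      using p mult_div_mod_eq[of t c] unfolding distrib_left by linarith
    then have "k * c + k * (t - ?p) = t * (k * (c div t + 1))"
      by (simp only: distrib_left[symmetric] mult.left_commute)
    then have "\<omega> ^ (k * c) * \<omega> ^ (k * (t - ?p)) = \<omega> ^ (t * (k * (c div t + 1)))"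
      by (simp only: power_add[symmetric])
    also have "\<dots> = 1" by (simp only: power_mult root_power(1) power_one)
    finally have "\<omega> ^ (k * (t - ?p)) = inverse ((\<omega> ^ k) ^ c)"
      by (simp add: power_mult inverse_unique)
    then show ?thesis by (simp add: power_int_minus)
  qed
  finally show ?thesis
    by (simp add: s power_int_mult_distrib)
qed

text \<open>The inverse matrix \<open>H\<close> consists of the inverse powers divided by
  \<open>t\<close>, which is nonzero in characteristic 0; the off-diagonal sums of the product are
  geometric sums over a \<open>t\<close>-th root of unity \<open>z\<close> other than 1.\<close>

lemma ldet_fourier_nonzero: "ldet fourier (List.product [0..<t] [0..<n]) rows \<noteq> 0"
proof -
  define K where "K = List.product [0..<t] [0..<n]"
  define H where "H r s = of_bool (snd r = snd s) * inverse (\<omega> ^ (fst s * fst r)) / of_nat t"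
    for r s :: "nat \<times> nat"
  have K: "set K = {..<t} \<times> {..<n}" "distinct K" "length K = t * n"
    unfolding K_def by (auto simp: distinct_product)
  have t0: "(of_nat t :: 'a) \<noteq> 0" using t by simp
  have "(\<Sum>r\<leftarrow>rows. fourier s r * H r s') = of_bool (s = s')" if mem: "s \<in> set K" "s' \<in> set K" for s s'
  proof -
    obtain k i where s: "s = (k, i)" "k < t" "i < n" using mem(1) unfolding K(1) by auto
    obtain k' i' where s': "s' = (k', i')" "k' < t" "i' < n" using mem(2) unfolding K(1) by auto
    define z where "z = \<omega> ^ k * inverse (\<omega> ^ k')"
    have zt: "z ^ t = 1"
    proof -
      have "(\<omega> ^ a) ^ t = 1" for a
        by (metis root_power(1) power_mult mult.commute power_one)
      then show ?thesis by (simp add: z_def power_mult_distrib power_inverse)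
    qed
    have z1: "z = 1 \<longleftrightarrow> k = k'"
    proof
      assume "z = 1"
      then have "\<omega> ^ k = \<omega> ^ k'" using root_power(2) by (simp add: z_def field_simps)
      then show "k = k'" by (rule root_power_inject[OF s(2) s'(2)])
    qed (use root_power(2) in \<open>simp add: z_def\<close>)
    have zsum: "(\<Sum>q\<in>{1..t}. z ^ q) = of_bool (k = k') * of_nat t"
    proof (cases "z = 1")
      case False
      have "(\<Sum>q\<in>{1..t}. z ^ q) = (\<Sum>q<t. z ^ Suc q)"
        by (rule sum.reindex_bij_witness[of _ Suc "\<lambda>q. q - 1"]) auto
      also have "\<dots> = z * (\<Sum>q<t. z ^ q)" by (simp add: sum_distrib_left)
      also have "\<dots> = 0" using False zt by (simp add: sum_gp_strict)
      finally show ?thesis using False z1 by simp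
    qed (use z1 in simp)
    have "(\<Sum>r\<leftarrow>rows. fourier s r * H r s') = (\<Sum>r\<in>{1..t} \<times> {..<n}. fourier s r * H r s')"
      using sum_list_distinct_conv_sum_set[OF distinct_rows] by (simp add: set_rows)
    also have "\<dots> = (\<Sum>q\<in>{1..t}. \<Sum>l\<in>{..<n}. fourier s (q, l) * H (q, l) s')"
      by (simp add: sum.cartesian_product)
    also have "\<dots> = (\<Sum>q\<in>{1..t}. of_bool (i = i') * z ^ q / of_nat t)"
    proof (rule sum.cong[OF refl])
      fix q
      have "(\<Sum>l\<in>{..<n}. fourier s (q, l) * H (q, l) s')
          = (\<Sum>l\<in>{..<n}. if l = i then of_bool (i = i') * z ^ q / of_nat t else 0)"
        by (rule sum.cong)
          (auto simp: fourier_def H_def s s' z_def power_mult power_mult_distrib power_inverse)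
      then show "(\<Sum>l\<in>{..<n}. fourier s (q, l) * H (q, l) s') = of_bool (i = i') * z ^ q / of_nat t"
        using s by simp
    qed
    also have "\<dots> = of_bool (i = i') * (\<Sum>q\<in>{1..t}. z ^ q) / of_nat t"
      by (simp add: sum_distrib_left sum_divide_distrib)
    also have "\<dots> = of_bool (s = s')"
      unfolding zsum using t0 by (auto simp: s s')
    finally show ?thesis .
  qed
  then have "ldet fourier K rows * ldet H rows K = ldet (\<lambda>s s'. of_bool (s = s')) K K"
    by (subst ldet_mult) (auto simp: K length_rows intro!: ldet_cong)
  also have "\<dots> = 1" by (rule ldet_identity[OF K(2)])
  finally show ?thesis unfolding K_def[symmetric] by auto
qed

text \<open>The Fourier factor does not depend on \<open>lam\<close>. It also contains the sign of
  the chosen order of \<open>rows\<close>, which therefore never has to be determined.\<close>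

lemma so_alternant_twisted:
  "so_alternant (\<lambda>j. int (part lam j)) (twisted t \<omega> X) =
    ldet fourier (List.product [0..<t] [0..<n]) rows * ldet entry rows (beta lam (t * n))"
proof -
  let ?K = "List.product [0..<t] [0..<n]"
  have len: "length (twisted t \<omega> X) = t * n" by (simp add: twisted_eq)
  have lb: "length (beta lam (t * n)) = t * n" by (simp add: beta_def del: upt_Suc)
  have E: "map (\<lambda>j. int (part lam (Suc j)) + int (t * n) - int (Suc j)) [0..<t * n] = map int (beta lam (t * n))"
    by (rule nth_equalityI) (auto simp: beta_def of_nat_diff simp del: upt_Suc)
  have "so_alternant (\<lambda>j. int (part lam j)) (twisted t \<omega> X) =
    ldet (\<lambda>s c. (\<omega> ^ fst s * X ! snd s) powi (int c + 1) - (\<omega> ^ fst s * X ! snd s) powi (- int c))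
      ?K (beta lam (t * n))"
    unfolding so_alternant_eq_ldet len E unfolding twisted_eq ldet_map ..
  also have "\<dots> = ldet (\<lambda>s c. \<Sum>r\<leftarrow>rows. fourier s r * entry r c) ?K (beta lam (t * n))"
    by (rule ldet_cong, rule fourier_entry[symmetric]) auto
  also have "\<dots> = ldet fourier ?K rows * ldet entry rows (beta lam (t * n))"
    by (rule ldet_mult[symmetric]) (auto simp: length_rows lb)
  finally show ?thesis .
qed

text \<open>The part of an entry that depends only on its row once multiples of \<open>t\<close> are
  split off the exponent: \<open>x powi (p + 1)\<close> at frequency \<open>p + 1\<close> and
  \<open>- (x powi (- p))\<close> at frequency \<open>t - p\<close>. In the middle block, where the
  frequencies coincide, \<open>x powi (- p)\<close> is taken without a sign.\<close>

definition weight :: "nat \<Rightarrow> nat \<times> nat \<Rightarrow> 'a" where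
  "weight p r = (if 2 * p + 1 = t \<or> fst r \<noteq> p + 1 then (X ! snd r) powi (- int p) else (X ! snd r) powi (int p + 1))
    * (if 2 * p + 1 \<noteq> t \<and> fst r \<noteq> p + 1 then - 1 else 1)"

definition block_weight :: "nat \<Rightarrow> 'a" where
  "block_weight p = prod_list (map (weight p) (row_block p))"

lemma block_weight_nonzero: "block_weight p \<noteq> 0"
proof -
  have "weight p r \<noteq> 0" if "r \<in> set (row_block p)" for r
  proof -
    have "X ! snd r \<noteq> 0" using that by (auto simp: set_row_block nth_X_nonzero)
    then show ?thesis by (simp add: weight_def)
  qed
  then show ?thesis unfolding block_weight_def prod_list_zero_iff by force
qed

lemma power_t_powi: "(x ^ t) powi k = (x :: 'a) powi (int t * k)" "(inverse x ^ t) powi k = x powi (- (int t * k))"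
proof -
  show *: "(x ^ t) powi k = x powi (int t * k)" for x :: 'a by (simp add: power_int_mult)
  show "(inverse x ^ t) powi k = x powi (- (int t * k))"
    unfolding * by (simp add: power_int_minus power_int_inverse)
qed

text \<open>Let \<open>d = c div t\<close>. For residue \<open>p\<close> the exponents are
  \<open>c + 1 = (p + 1) + t * d\<close> and \<open>- c = - p - t * d\<close>. For residue
  \<open>t - 1 - p\<close> they are \<open>- c = (p + 1) + t * (- d - 1)\<close> and
  \<open>c + 1 = - p - t * (- d - 1)\<close>; hence \<open>- d - 1\<close>, and one sign per column
  of that residue.\<close>

lemma entry_pair:
  assumes p: "p < t div 2" and r: "r \<in> set (row_block p)" and c: "c mod t = p \<or> c mod t = t - 1 - p"
  shows "entry r c = weight p r * (if c mod t = p then 1 else - 1) *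
    (if fst r = p + 1 then (X ! snd r) ^ t else inverse (X ! snd r) ^ t)
      powi (if c mod t = p then int (c div t) else - int (c div t) - 1)"
proof -
  obtain q i where qi: "r = (q, i)" "q = p + 1 \<or> q = t - p" "i < n"
    using r by (auto simp: set_row_block)
  define x where "x = X ! i"
  have x: "x \<noteq> 0" using nth_X_nonzero qi by (simp add: x_def)
  then have P: "x powi (a + b) = x powi a * x powi b" for a b by (simp add: power_int_add)
  have ne: "p \<noteq> t - 1 - p" "2 * p + 1 \<noteq> t" "t - p \<noteq> p + 1" "p < t" using p by auto
  have cc: "int c = int t * int (c div t) + int (c mod t)"
    by (simp flip: of_nat_mult of_nat_add)
  have tp: "int (t - 1 - p) = int t - 1 - int p" using p by simp
  show ?thesis
  proof (cases "c mod t = p")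
    case True
    then have c': "int c = int t * int (c div t) + int p" using cc by simp
    have e1: "int c + 1 = (int p + 1) + int t * int (c div t)" using c' by simp
    have e2: "- int c = - int p + - (int t * int (c div t))" using c' by simp
    from qi(2) show ?thesis
    proof
      assume "q = p + 1"
      then have "entry r c = x powi (int c + 1)"
        using True ne by (auto simp: entry_def qi x_def)
      then have "entry r c = x powi (int p + 1) * (x ^ t) powi int (c div t)"
        by (simp only: e1 P power_t_powi(1))
      then show ?thesis
        using \<open>q = p + 1\<close> True ne by (simp add: weight_def qi flip: x_def)
    next
      assume "q = t - p"
      then have "entry r c = - (x powi (- int c))"
        using True ne by (auto simp: entry_def qi x_def)
      then have "entry r c = - (x powi (- int p) * (inverse x ^ t) powi int (c div t))"
        by (simp only: e2 P power_t_powi(2))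
      then show ?thesis
        using \<open>q = t - p\<close> True ne by (simp add: weight_def qi flip: x_def)
    qed
  next
    case False
    then have cm: "c mod t = t - 1 - p" using c by simp
    then have c': "int c = int t * int (c div t) + (int t - 1 - int p)" using cc tp by simp
    have e1: "- int c = (int p + 1) + int t * (- int (c div t) - 1)" using c' by (simp add: algebra_simps)
    have e2: "int c + 1 = - int p + - (int t * (- int (c div t) - 1))" using c' by (simp add: algebra_simps)
    from qi(2) show ?thesis
    proof
      assume "q = p + 1"
      then have "entry r c = - (x powi (- int c))"
        using cm ne by (auto simp: entry_def qi x_def)
      then have "entry r c = - (x powi (int p + 1) * (x ^ t) powi (- int (c div t) - 1))"
        by (simp only: e1 P power_t_powi(1))
      then show ?thesis
        using \<open>q = p + 1\<close> False ne by (simp add: weight_def qi flip: x_def)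
    next
      assume "q = t - p"
      then have "entry r c = x powi (int c + 1)"
        using cm ne by (auto simp: entry_def qi x_def)
      then have "entry r c = x powi (- int p) * (inverse x ^ t) powi (- int (c div t) - 1)"
        by (simp only: e2 P power_t_powi(2))
      then show ?thesis
        using \<open>q = t - p\<close> False ne by (simp add: weight_def qi flip: x_def)
    qed
  qed
qed

text \<open>The reversal of \<open>B\<close> suits decreasing lists: the exponents
  \<open>- d - 1\<close> then decrease as well, and being negative they continue the nonnegative
  ones from \<open>A\<close>.\<close>

lemma ldet_pair_block:
  assumes p: "p < t div 2"
    and A: "\<And>c. c \<in> set A \<Longrightarrow> c mod t = p" and B: "\<And>c. c \<in> set B \<Longrightarrow> c mod t = t - 1 - p"
    and len: "length A + length B = 2 * n"
  shows "ldet entry (row_block p) (A @ rev B) = block_weight p * (- 1) ^ length B *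
    ldet (\<lambda>y e. y powi e) Z (map (\<lambda>c. int (c div t)) A @ map (\<lambda>c. - int (c div t) - 1) (rev B))"
proof -
  define v where "v c = (if c mod t = p then 1 else - 1 :: 'a)" for c
  define e where "e c = (if c mod t = p then int (c div t) else - int (c div t) - 1)" for c
  define z where "z r = (if fst r = p + 1 then (X ! snd r) ^ t else inverse (X ! snd r) ^ t)" for r :: "nat \<times> nat"
  have ne: "p \<noteq> t - 1 - p" "2 * p + 1 \<noteq> t" "t - p \<noteq> p + 1" using p by auto
  have "ldet entry (row_block p) (A @ rev B) =
      ldet (\<lambda>r c. weight p r * v c * (z r powi e c)) (row_block p) (A @ rev B)"
    unfolding v_def e_def z_def by (rule ldet_cong, rule entry_pair[OF p]) (use A B in auto)
  also have "\<dots> = block_weight p * prod_list (map v (A @ rev B)) *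
      ldet (\<lambda>r c. z r powi e c) (row_block p) (A @ rev B)"
    unfolding block_weight_def by (rule ldet_scale) (use len ne in \<open>simp add: length_row_block\<close>)
  also have "prod_list (map v (A @ rev B)) = (- 1) ^ length B"
  proof -
    have const: "prod_list (map v L) = k ^ length L" if "\<And>c. c \<in> set L \<Longrightarrow> v c = k" for L k
      using that by (induction L) auto
    have "v c = 1" if "c \<in> set A" for c using A[OF that] by (simp add: v_def)
    moreover have "v c = - 1" if "c \<in> set (rev B)" for c using B[of c] that ne by (simp add: v_def)
    ultimately show ?thesis using const[of A 1] const[of "rev B" "- 1"] by simp
  qed
  also have "ldet (\<lambda>r c. z r powi e c) (row_block p) (A @ rev B)
      = ldet (\<lambda>y e. y powi e) (map z (row_block p)) (map e (A @ rev B))"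
    by (rule ldet_map[symmetric])
  also have "map z (row_block p) = Z"
    using ne by (auto simp: row_block_def z_def length_X intro!: nth_equalityI simp: nth_append)
  also have "map e (A @ rev B) = map (\<lambda>c. int (c div t)) A @ map (\<lambda>c. - int (c div t) - 1) (rev B)"
    using A B ne by (auto simp: e_def)
  finally show ?thesis .
qed

lemma ldet_middle_block:
  assumes p: "2 * p + 1 = t" and A: "\<And>c. c \<in> set A \<Longrightarrow> c mod t = p" and len: "length A = n"
  shows "ldet entry (row_block p) A = block_weight p *
    ldet (\<lambda>y e. y powi (e + 1) - y powi (- e)) Xt (map (\<lambda>c. int (c div t)) A)"
proof -
  let ?f = "\<lambda>(y :: 'a) e. y powi (e + 1) - y powi (- e)"
  have "ldet entry (row_block p) A =
      ldet (\<lambda>r c. weight p r * 1 * ?f ((X ! snd r) ^ t) (int (c div t))) (row_block p) A"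
  proof (rule ldet_cong)
    fix r c assume "r \<in> set (row_block p)" "c \<in> set A"
    then obtain i where r: "r = (p + 1, i)" "i < n" and c: "c mod t = p"
      using p A by (auto simp: row_block_def)
    define x where "x = X ! i"
    have x: "x \<noteq> 0" using nth_X_nonzero r by (simp add: x_def)
    then have P: "x powi (a + b) = x powi a * x powi b" for a b by (simp add: power_int_add)
    have "int c = int t * int (c div t) + int (c mod t)"
      by (simp flip: of_nat_mult of_nat_add)
    then have c': "int c = int t * int (c div t) + int p" using c by simp
    have tt: "int t = 2 * int p + 1" using p by simp
    \<comment> \<open>Since \<open>t = 2 * p + 1\<close>, both exponents are congruent to
      \<open>- p\<close> modulo \<open>t\<close>, so \<open>x powi (- p)\<close> factors out and an
      odd orthogonal entry in \<open>x ^ t\<close> remains.\<close>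
    have e: "int c + 1 = - int p + int t * (int (c div t) + 1)" "- int c = - int p + int t * (- int (c div t))"
      using c' tt by (simp_all add: algebra_simps)
    have "entry r c = x powi (int c + 1) - x powi (- int c)"
      using p c by (auto simp: entry_def r x_def)
    then have "entry r c = x powi (- int p) * (x ^ t) powi (int (c div t) + 1)
        - x powi (- int p) * (x ^ t) powi (- int (c div t))"
      by (simp only: e P power_t_powi)
    moreover have "weight p r = x powi (- int p)"
      using p by (simp add: weight_def r x_def)
    ultimately show "entry r c = weight p r * 1 * ?f ((X ! snd r) ^ t) (int (c div t))"
      by (simp only: r snd_conv x_def[symmetric] right_diff_distrib mult_1_right)
  qed
  also have "\<dots> = block_weight p * prod_list (map (\<lambda>_. 1) A) *
      ldet (\<lambda>r c. ?f ((X ! snd r) ^ t) (int (c div t))) (row_block p) A"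
    unfolding block_weight_def by (rule ldet_scale) (use p len in \<open>simp add: length_row_block\<close>)
  also have "ldet (\<lambda>r c. ?f ((X ! snd r) ^ t) (int (c div t))) (row_block p) A
      = ldet ?f (map (\<lambda>r. (X ! snd r) ^ t) (row_block p)) (map (\<lambda>c. int (c div t)) A)"
    by (rule ldet_map[symmetric])
  also have "map (\<lambda>r. (X ! snd r) ^ t) (row_block p) = Xt"
    using p by (auto simp: row_block_def length_X intro!: nth_equalityI)
  finally show ?thesis by (simp add: map_replicate_const)
qed

lemma Z_nonzero: "0 \<notin> set Z"
  using nonzero by auto

lemma prod_Z: "prod_list Z = 1"
proof -
  have "prod_list (map (\<lambda>x. x ^ t) Y @ map (\<lambda>x. inverse x ^ t) Y) = 1" if "0 \<notin> set Y" for Y :: "'a list"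
    using that by (induction Y) (auto simp: power_inverse field_simps)
  then show ?thesis using nonzero by blast
qed

lemma schur_alternant_mu3:
  assumes lam: "is_partition lam" "length lam \<le> t * n" and p: "p < t"
    and bal: "n_residue t lam (t * n) p + n_residue t lam (t * n) (t - 1 - p) = 2 * n"
  shows "schur_alternant (mu3 t n lam p) Z = ldet (\<lambda>y e. y powi e) Z
    (map (\<lambda>c. int (c div t)) (beta_residue t lam (t * n) p)
      @ map (\<lambda>c. - int (c div t) - 1) (rev (beta_residue t lam (t * n) (t - 1 - p))))"
proof -
  define A where "A = beta_residue t lam (t * n) p"
  define B where "B = beta_residue t lam (t * n) (t - 1 - p)"
  let ?E = "map (\<lambda>c. int (c div t)) A @ map (\<lambda>c. - int (c div t) - 1) (rev B)"
  \<comment> \<open>The first summand is the shift built into \<open>mu3\<close>. The second arises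
    because quotient parts in class \<open>p\<close> are normalised by \<open>length A\<close>,
    whereas the alternant has \<open>2 * n = length A + length B\<close> columns.\<close>
  define K where "K = int (part (t_quotient t lam (t * n) (t - 1 - p)) 1) + int (length B)"
  have len: "length A + length B = 2 * n" using bal by (simp add: n_residue_def A_def B_def)
  have lZ: "length Z = 2 * n" by (simp add: length_X)
  have qA: "int (part (t_quotient t lam (t * n) p) (Suc j)) = int (A ! j div t) + int (Suc j) - int (length A)"
    if "j < length A" for j
    using part_t_quotient[OF lam, of j t p] that by (simp add: n_residue_def A_def)
  have qB: "int (part (t_quotient t lam (t * n) (t - 1 - p)) (Suc j)) = int (B ! j div t) + int (Suc j) - int (length B)"
    if "j < length B" for j
    using part_t_quotient[OF lam, of j t "t - 1 - p"] that by (simp add: n_residue_def B_def)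
  have "map (\<lambda>j. mu3 t n lam p (Suc j) + int (2 * n) - int (Suc j)) [0..<2 * n] = map ((+) K) ?E"
  proof (rule nth_equalityI)
    fix j assume "j < length (map (\<lambda>j. mu3 t n lam p (Suc j) + int (2 * n) - int (Suc j)) [0..<2 * n])"
    then have j: "j < 2 * n" by simp
    show "map (\<lambda>j. mu3 t n lam p (Suc j) + int (2 * n) - int (Suc j)) [0..<2 * n] ! j = map ((+) K) ?E ! j"
    proof (cases "j < length A")
      case True
      have "mu3 t n lam p (Suc j) + int (2 * n) - int (Suc j) = K + int (A ! j div t)"
        using qA[OF True] True len unfolding mu3_def K_def Let_def
        by (simp add: n_residue_def flip: A_def B_def)
      then show ?thesis using True j by (simp add: nth_append)
    next
      case False
      \<comment> \<open>Column \<open>j\<close> of the alternant comes from entry \<open>l\<close>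
        of \<open>B\<close>, counted from 0 and before the reversal.\<close>
      define l where "l = 2 * n - Suc j"
      have l: "l < length B" "2 * n + 1 - Suc j = Suc l" "int j = int (2 * n) - int l - 1"
        using False j len by (auto simp: l_def)
      have "mu3 t n lam p (Suc j) = int (part (t_quotient t lam (t * n) (t - 1 - p)) 1)
          - int (part (t_quotient t lam (t * n) (t - 1 - p)) (Suc l))"
        using False unfolding mu3_def Let_def l(2) by (simp add: n_residue_def flip: A_def)
      then have "mu3 t n lam p (Suc j) + int (2 * n) - int (Suc j) = K + (- int (B ! l div t) - 1)"
        using qB[OF l(1)] l(3) by (simp add: K_def)
      moreover have "?E ! j = - int (B ! l div t) - 1"
      proof -
        have "j - length A < length B" "length B - Suc (j - length A) = l"
          using False j len by (auto simp: l_def)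
        then show ?thesis using False by (simp add: nth_append rev_nth rev_map)
      qed
      moreover have "map ((+) K) ?E ! j = K + ?E ! j"
        using j len by (subst nth_map) auto
      ultimately show ?thesis using j by simp
    qed
  qed (use len in simp)
  then have "schur_alternant (mu3 t n lam p) Z = ldet (\<lambda>y e. y powi e) Z (map ((+) K) ?E)"
    unfolding schur_alternant_eq_ldet lZ by simp
  also have "\<dots> = ldet (\<lambda>y e. y powi e) Z ?E"
    by (rule ldet_powi_shift[OF Z_nonzero prod_Z]) (use len in \<open>simp add: length_X\<close>)
  finally show ?thesis by (simp add: A_def B_def)
qed

lemma so_alternant_middle:
  assumes lam: "is_partition lam" "length lam \<le> t * n" and "n_residue t lam (t * n) p = n"
  shows "so_alternant (\<lambda>j. int (part (t_quotient t lam (t * n) p) j)) Xt =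
    ldet (\<lambda>y e. y powi (e + 1) - y powi (- e)) Xt
      (map (\<lambda>c. int (c div t)) (beta_residue t lam (t * n) p))"
proof -
  have "map (\<lambda>j. int (part (t_quotient t lam (t * n) p) (Suc j)) + int n - int (Suc j)) [0..<n]
      = map (\<lambda>c. int (c div t)) (beta_residue t lam (t * n) p)"
    using assms(3) part_t_quotient[OF lam, of _ t p] by (intro nth_equalityI) (auto simp: n_residue_def)
  then show ?thesis unfolding so_alternant_eq_ldet by (simp add: length_X)
qed

text \<open>Each pair of residues \<open>y\<close>, \<open>t - 1 - y\<close> is labelled by its
  minimum, and a row by the pair it meets. The label \<open>x\<close> is carried by the rows of
  frequencies \<open>x + 1\<close> and \<open>t - x\<close>: \<open>2 * n\<close> rows, or
  \<open>n\<close> when the two coincide, in which case the residue is its own partner.\<close>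

lemma ldet_entry_nonzero_balanced:
  assumes "ldet entry rows (beta lam (t * n)) \<noteq> 0" "i < t"
  shows "n_residue t lam (t * n) i + n_residue t lam (t * n) (t - 1 - i) = 2 * n"
proof -
  define u where "u r = min (fst r - 1) (t - fst r)" for r :: "nat \<times> nat"
  define v where "v c = min (c mod t) (t - 1 - c mod t)" for c
  define x where "x = min i (t - 1 - i)"
  let ?N = "n_residue t lam (t * n)"
  have xt: "x \<le> t - 1 - x" "x < t" using assms(2) by (auto simp: x_def)
  have "mset (map u rows) = mset (map v (beta lam (t * n)))"
  proof (rule ldet_nonzero_classes[OF assms(1)])
    fix r c assume r: "r \<in> set rows" and "entry r c \<noteq> 0"
    then have "c mod t = fst r - 1 \<or> c mod t = t - fst r" by (auto simp: entry_def split: if_splits)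
    moreover have "1 \<le> fst r" "fst r \<le> t" using r by (auto simp: set_rows)
    ultimately show "u r = v c" by (auto simp: u_def v_def)
  qed
  then have *: "count (mset (map u rows)) x = count (mset (map v (beta lam (t * n)))) x" by simp
  then have eq: "length (filter (\<lambda>r. u r = x) rows) = length (filter (\<lambda>c. v c = x) (beta lam (t * n)))"
  proof -
    have "count (mset (map u L)) x = length (filter (\<lambda>r. u r = x) L)" for L by (induction L) auto
    moreover have "count (mset (map v L)) x = length (filter (\<lambda>c. v c = x) L)" for L by (induction L) auto
    ultimately show ?thesis using * by simp
  qed
  have "length (filter (\<lambda>r. u r = x) rows) = card ({q \<in> {1..t}. min (q - 1) (t - q) = x} \<times> {..<n})"
  proof -
    have "set (filter (\<lambda>r. u r = x) rows) = {q \<in> {1..t}. min (q - 1) (t - q) = x} \<times> {..<n}"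
      by (auto simp: set_rows u_def)
    then show ?thesis using distinct_card[of "filter (\<lambda>r. u r = x) rows"] distinct_rows by simp
  qed
  also have "{q \<in> {1..t}. min (q - 1) (t - q) = x} = {x + 1, t - x}"
    using xt by (auto simp: min_def split: if_splits)
  finally have rows: "length (filter (\<lambda>r. u r = x) rows) = card {x + 1, t - x} * n"
    by (simp add: card_cartesian_product)
  have v_iff: "v c = x \<longleftrightarrow> c mod t = x \<or> c mod t = t - 1 - x" for c
  proof -
    have "min y (t - 1 - y) = x \<longleftrightarrow> y = x \<or> y = t - 1 - x" if "y < t" for y
      using xt that by (auto simp: min_def)
    then show ?thesis using t by (simp add: v_def)
  qed
  have sym: "?N i + ?N (t - 1 - i) = ?N x + ?N (t - 1 - x)"
    using assms(2) by (auto simp: x_def min_def)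
  show ?thesis
  proof (cases "x = t - 1 - x")
    case True
    then have "t - x = x + 1" using xt by auto
    then have "?N x = n"
      using eq rows True by (simp add: v_iff n_residue_def beta_residue_def)
    then show ?thesis using sym True by simp
  next
    case False
    have "length (filter (\<lambda>c. c mod t = x \<or> c mod t = t - 1 - x) L)
        = length (filter (\<lambda>c. c mod t = x) L) + length (filter (\<lambda>c. c mod t = t - 1 - x) L)" for L
      using False by (induction L) auto
    then have "?N x + ?N (t - 1 - x) = card {x + 1, t - x} * n"
      using eq rows by (simp add: v_iff n_residue_def beta_residue_def)
    moreover have "card {x + 1, t - x} = 2" using False xt by auto
    ultimately show ?thesis using sym by simp
  qed
qed

section \<open>Assembling blocks, signs and the denominator\<close>

definition balanced :: "nat list \<Rightarrow> bool" where
  "balanced lam \<longleftrightarrow> is_partition lam \<and> length lam \<le> t * n \<and>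
     (\<forall>i<t. n_residue t lam (t * n) i + n_residue t lam (t * n) (t - 1 - i) = 2 * n)"

text \<open>What is left of a block after \<open>block_weight\<close>; the power of -1 comes from
  the columns of residue \<open>t - 1 - p\<close>.\<close>

definition block_factor :: "nat list \<Rightarrow> nat \<Rightarrow> 'a" where
  "block_factor lam p =
     (if 2 * p + 1 = t then so_alternant (\<lambda>j. int (part (t_quotient t lam (t * n) p) j)) Xt
      else (- 1) ^ n_residue t lam (t * n) (t - 1 - p) * schur_alternant (mu3 t n lam p) Z)"

text \<open>The count of \<open>swaps_fold\<close> for a balanced partition: the
  \<open>t - 2 - 2 * q\<close> residues strictly between \<open>q\<close> and
  \<open>t - 1 - q\<close> hold \<open>n\<close> beta numbers on average.\<close>

definition fold_swaps :: "nat list \<Rightarrow> nat" where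
  "fold_swaps lam = (\<Sum>q<t div 2. (n_residue t lam (t * n) (t - 1 - q) choose 2)
     + n_residue t lam (t * n) (t - 1 - q) * (n * (t - 2 - 2 * q)))"

lemma ldet_entry_sorted:
  assumes "balanced lam"
  shows "ldet entry rows (concat (map (beta_residue t lam (t * n)) [0..<t])) =
    (- 1) ^ fold_swaps lam * (\<Prod>p<(t + 1) div 2. block_weight p * block_factor lam p)"
proof -
  let ?C = "beta_residue t lam (t * n)" and ?N = "n_residue t lam (t * n)"
  define F where "F p = (if 2 * p + 1 = t then ?C p else ?C p @ rev (?C (t - 1 - p)))" for p
  have lam: "is_partition lam" "length lam \<le> t * n"
    and bal: "\<And>i. i < t \<Longrightarrow> ?N i + ?N (t - 1 - i) = 2 * n"
    using assms by (auto simp: balanced_def)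
  have lenC: "length (?C i) = ?N i" for i by (simp add: n_residue_def)
  have modC: "c mod t = i" if "c \<in> set (?C i)" for c i using that by (simp add: beta_residue_def)
  have inner: "(\<Sum>u\<in>{Suc q..<t - 1 - q}. ?N u) = n * (t - 2 - 2 * q)" if "q < t div 2" for q
  proof -
    let ?U = "{Suc q..<t - 1 - q}"
    \<comment> \<open>The reflection \<open>t - 1 - u\<close> preserves the range and pairs each
      residue with its partner, so twice the sum is \<open>2 * n\<close> per residue.\<close>
    have "(\<Sum>u\<in>?U. ?N u) = (\<Sum>u\<in>?U. ?N (t - 1 - u))"
      by (rule sum.reindex_bij_witness[of _ "\<lambda>u. t - 1 - u" "\<lambda>u. t - 1 - u"]) auto
    then have "2 * (\<Sum>u\<in>?U. ?N u) = (\<Sum>u\<in>?U. ?N u + ?N (t - 1 - u))"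
      by (simp add: sum.distrib)
    also have "\<dots> = (\<Sum>u\<in>?U. 2 * n)" by (rule sum.cong) (use bal in auto)
    also have "\<dots> = 2 * (n * (t - 2 - 2 * q))"
    proof -
      have "t - 1 - q - Suc q = t - 2 - 2 * q" by simp
      then show ?thesis by simp
    qed
    finally show ?thesis by simp
  qed
  have "swaps (fold_swaps lam) (concat (map ?C [0..<t])) (concat (map F [0..<(t + 1) div 2]))"
  proof -
    have "(\<Sum>q\<in>{0..<t div 2}. (length (?C (t - 1 - q)) choose 2)
        + length (?C (t - 1 - q)) * (\<Sum>u\<in>{Suc q..<t - 1 - q}. length (?C u))) = fold_swaps lam"
      unfolding fold_swaps_def lenC atLeast0LessThan
      by (rule sum.cong[OF refl]) (simp only: lessThan_iff inner)
    then show ?thesis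
      using swaps_fold[of 0 t ?C] unfolding F_def by simp
  qed
  moreover have "length rows = length (concat (map ?C [0..<t]))"
  proof -
    have "2 * (\<Sum>u<t. ?N u) = (\<Sum>u<t. ?N u) + (\<Sum>u<t. ?N (t - 1 - u))"
      using sum.nat_diff_reindex[of ?N t] by simp
    also have "\<dots> = (\<Sum>u<t. 2 * n)"
      unfolding sum.distrib[symmetric] by (rule sum.cong) (use bal in auto)
    finally have "(\<Sum>u<t. ?N u) = t * n" by simp
    then show ?thesis
      by (simp add: length_rows length_concat comp_def lenC sum_list_distinct_conv_sum_set atLeast0LessThan)
  qed
  ultimately have "ldet entry rows (concat (map F [0..<(t + 1) div 2]))
      = (- 1) ^ fold_swaps lam * ldet entry rows (concat (map ?C [0..<t]))"
    by (rule ldet_swaps)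
  then have "ldet entry rows (concat (map ?C [0..<t]))
      = (- 1) ^ fold_swaps lam * ldet entry rows (concat (map F [0..<(t + 1) div 2]))"
    by (simp flip: mult.assoc power_add)
  also have "ldet entry rows (concat (map F [0..<(t + 1) div 2]))
      = (\<Prod>p\<in>set [0..<(t + 1) div 2]. ldet entry (row_block p) (F p))"
    unfolding rows_def
  proof (rule ldet_concat)
    fix p assume "p \<in> set [0..<(t + 1) div 2]"
    then have "p < t" "2 * p + 1 = t \<Longrightarrow> t - 1 - p = p" using t by auto
    then show "length (row_block p) = length (F p)"
      using bal[of p] by (auto simp: length_row_block F_def lenC)
  next
    fix p q r c
    assume pq: "p \<in> set [0..<(t + 1) div 2]" "q \<in> set [0..<(t + 1) div 2]" "p \<noteq> q"
      and r: "r \<in> set (row_block p)" and c: "c \<in> set (F q)"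
    have "c mod t = q \<or> c mod t = t - 1 - q"
      using c modC by (auto simp: F_def split: if_splits)
    moreover have "fst r = p + 1 \<or> fst r = t - p" using r by (auto simp: set_row_block)
    ultimately have "c mod t \<noteq> fst r - 1" "c mod t \<noteq> t - fst r" using pq by auto
    then show "entry r c = 0" by (simp add: entry_def)
  qed simp
  also have "\<dots> = (\<Prod>p<(t + 1) div 2. block_weight p * block_factor lam p)"
  proof (rule prod.cong)
    fix p assume "p \<in> {..<(t + 1) div 2}"
    then have p: "p < t" using t by auto
    show "ldet entry (row_block p) (F p) = block_weight p * block_factor lam p"
    proof (cases "2 * p + 1 = t")
      case True
      then have "t - 1 - p = p" by simp
      then have "?N p = n" using bal[OF p] by simp
      then show ?thesis
        using ldet_middle_block[OF True, of "?C p"] so_alternant_middle[OF lam, of p] modC True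
        by (simp add: F_def block_factor_def lenC)
    next
      case False
      then have "p < t div 2" using \<open>p \<in> {..<(t + 1) div 2}\<close> by auto
      then have "ldet entry (row_block p) (?C p @ rev (?C (t - 1 - p))) = block_weight p * (- 1) ^ ?N (t - 1 - p)
          * schur_alternant (mu3 t n lam p) Z"
        unfolding schur_alternant_mu3[OF lam p bal[OF p]] lenC[symmetric]
        by (rule ldet_pair_block) (use bal[OF p] in \<open>auto simp: modC lenC\<close>)
      then show ?thesis using False by (simp add: F_def block_factor_def)
    qed
  qed (simp add: atLeast0LessThan)
  finally show ?thesis .
qed

lemma balanced_Nil: "balanced []"
  unfolding balanced_def
  by (auto simp: is_partition_def n_residue_def beta_residue_Nil)

lemma n_residue_Nil: "i < t \<Longrightarrow> n_residue t [] (t * n) i = n"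
  by (simp add: n_residue_def beta_residue_Nil)

text \<open>The Fourier determinant and the block weights cancel against those of the empty
  partition. The sign of \<open>\<sigma>\<close> sorts the numerator, while the explicit count of
  \<open>swaps_beta_Nil\<close> sorts the denominator; signs are their own inverses, so the
  exponents add.\<close>

lemma so_char_twisted_eq:
  assumes bal: "balanced lam" and \<sigma>: "is_residue_sorting t lam (t * n) \<sigma>"
  shows "so_char (\<lambda>j. int (part lam j)) (twisted t \<omega> X) =
    of_int (sign \<sigma>) *
    (- 1) ^ (fold_swaps lam + ((t choose 2) * (Suc n choose 2) + fold_swaps []))
    * (\<Prod>p<(t + 1) div 2. block_factor lam p / block_factor [] p)"
proof -
  let ?G = "ldet fourier (List.product [0..<t] [0..<n]) rows"
  let ?W = "\<Prod>p<(t + 1) div 2. block_weight p"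
  let ?P = "\<lambda>lam. \<Prod>p<(t + 1) div 2. block_factor lam p"
  have lb: "length (beta mu (t * n)) = t * n" for mu by (simp add: beta_def del: upt_Suc)
  have prodW: "(\<Prod>p<(t + 1) div 2. block_weight p * block_factor mu p) = ?W * ?P mu" for mu
    by (rule prod.distrib)
  have W: "?W \<noteq> 0" by (simp add: block_weight_nonzero)
  have "ldet entry rows (concat (map (beta_residue t lam (t * n)) [0..<t]))
      = of_int (sign \<sigma>) * ldet entry rows (beta lam (t * n))"
    using \<sigma> ldet_permute_atLeast1[of \<sigma> "beta lam (t * n)" rows entry]
    by (simp add: is_residue_sorting_def lb length_rows del: upt_Suc)
  moreover have "of_int (sign \<sigma>) * of_int (sign \<sigma>) = (1 :: 'a)"
    by (simp add: sign_def)
  ultimately have "ldet entry rows (beta lam (t * n))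
      = of_int (sign \<sigma>) * ldet entry rows (concat (map (beta_residue t lam (t * n)) [0..<t]))"
    by (simp flip: mult.assoc)
  then have num: "so_alternant (\<lambda>j. int (part lam j)) (twisted t \<omega> X)
      = ?G * (of_int (sign \<sigma>) * ((- 1) ^ fold_swaps lam * (?W * ?P lam)))"
    unfolding so_alternant_twisted ldet_entry_sorted[OF bal] prodW by simp
  have "ldet entry rows (concat (map (beta_residue t [] (t * n)) [0..<t]))
      = (- 1) ^ ((t choose 2) * (Suc n choose 2)) * ldet entry rows (beta [] (t * n))"
    by (rule ldet_swaps[OF swaps_beta_Nil]) (simp add: lb length_rows)
  then have "ldet entry rows (beta [] (t * n)) = (- 1) ^ ((t choose 2) * (Suc n choose 2))
      * ldet entry rows (concat (map (beta_residue t [] (t * n)) [0..<t]))"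
    by (simp flip: mult.assoc power_add)
  then have "so_alternant (\<lambda>j. int (part [] j)) (twisted t \<omega> X)
      = ?G * ((- 1) ^ ((t choose 2) * (Suc n choose 2)) * ((- 1) ^ fold_swaps [] * (?W * ?P [])))"
    unfolding so_alternant_twisted ldet_entry_sorted[OF balanced_Nil] prodW by simp
  moreover have Nil0: "(\<lambda>j. int (part [] j)) = (\<lambda>_. 0)" by (simp add: part_def fun_eq_iff)
  ultimately have den: "so_alternant (\<lambda>_. 0) (twisted t \<omega> X)
      = ?G * ((- 1) ^ ((t choose 2) * (Suc n choose 2) + fold_swaps []) * (?W * ?P []))"
    by (simp add: Nil0 power_add mult.assoc)
  have inv: "x / (- 1) ^ k = x * (- 1) ^ k" for x :: 'a and k
    by (cases "even k") auto
  have "so_char (\<lambda>j. int (part lam j)) (twisted t \<omega> X)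
      = (of_int (sign \<sigma>) * (- 1) ^ fold_swaps lam) / (- 1) ^ ((t choose 2) * (Suc n choose 2) + fold_swaps [])
        * (?P lam / ?P [])"
    unfolding so_char_def num den using W ldet_fourier_nonzero by simp
  then show ?thesis
    by (simp only: inv) (simp only: power_add prod_dividef mult_ac)
qed

text \<open>The summand \<open>n\<close> in the exponent of -1 comes from the empty partition, which
  has \<open>n\<close> beta numbers in each residue class.\<close>

lemma block_factor_quotient:
  "(\<Prod>p<(t + 1) div 2. block_factor lam p / block_factor [] p) =
    (- 1) ^ (\<Sum>q<t div 2. n_residue t lam (t * n) (t - 1 - q) + n)
    * (\<Prod>i = 0..(t - 2) div 2. schur (mu3 t n lam i) Z)
    * (if odd t then so_char (\<lambda>j. int (part (t_quotient t lam (t * n) ((t - 1) div 2)) j)) Xt else 1)"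
proof -
  let ?N = "n_residue t lam (t * n)"
  let ?q = "\<lambda>p. block_factor lam p / block_factor [] p"
  have pair: "?q p = (- 1) ^ (?N (t - 1 - p) + n) * schur (mu3 t n lam p) Z" if "p < t div 2" for p
  proof -
    have p: "2 * p + 1 \<noteq> t" "p < t" "t - 1 - p < t" using that by auto
    have "?q p = ((- 1) ^ ?N (t - 1 - p) * schur_alternant (mu3 t n lam p) Z)
        / ((- 1) ^ n * schur_alternant (\<lambda>_. 0) Z)"
      using p by (simp add: block_factor_def mu3_Nil n_residue_Nil)
    then show ?thesis
      by (cases "even n") (auto simp: schur_def power_add)
  qed
  have mid: "?q (t div 2) = so_char (\<lambda>j. int (part (t_quotient t lam (t * n) ((t - 1) div 2)) j)) Xt"
    if "odd t"
  proof -
    have h: "2 * (t div 2) + 1 = t" "t div 2 < t" "(t - 1) div 2 = t div 2" using that by presburger+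
    show ?thesis
      unfolding h(3) so_char_def using h(1) by (simp add: block_factor_def part_t_quotient_Nil[OF h(2)])
  qed
  have "(\<Prod>p<t div 2. ?q p) = (\<Prod>p<t div 2. (- 1) ^ (?N (t - 1 - p) + n) * schur (mu3 t n lam p) Z)"
    by (rule prod.cong) (auto simp: pair)
  also have "\<dots> = (- 1) ^ (\<Sum>q<t div 2. ?N (t - 1 - q) + n) * (\<Prod>p<t div 2. schur (mu3 t n lam p) Z)"
    by (simp only: prod.distrib power_sum)
  finally have lo: "(\<Prod>p<t div 2. ?q p) = (- 1) ^ (\<Sum>q<t div 2. ?N (t - 1 - q) + n)
      * (\<Prod>p<t div 2. schur (mu3 t n lam p) Z)" .
  have idx: "{..<t div 2} = {0..(t - 2) div 2}" using t by auto
  show ?thesis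
  proof (cases "odd t")
    case True
    then have "(t + 1) div 2 = Suc (t div 2)" by presburger
    then show ?thesis using lo mid[OF True] True by (simp add: idx)
  next
    case False
    then have "(t + 1) div 2 = t div 2" by presburger
    then show ?thesis using lo False by (simp add: idx)
  qed
qed

end

theorem theorem2p17:
  fixes t n :: nat and \<omega> :: "'a::field_char_0" and X :: "'a list"
    and lam rho :: "nat list" and \<sigma> :: "nat \<Rightarrow> nat"
  assumes "t \<ge> 2" and "n \<ge> 1"
    and "primitive_root_of_unity t \<omega>"
    and "length X = n" and "0 \<notin> set X"
    and "distinct (map (\<lambda>x. x ^ t) X @ map (\<lambda>x. inverse x ^ t) X)"
    and "is_partition lam" and "length lam \<le> t * n"
    and "is_core_of t rho lam"
    and "is_residue_sorting t lam (t * n) \<sigma>"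
  shows
    "(\<not> self_conjugate rho \<longrightarrow> so_char (\<lambda>j. int (part lam j)) (twisted t \<omega> X) = 0) \<and>
     (self_conjugate rho \<longrightarrow>
        so_char (\<lambda>j. int (part lam j)) (twisted t \<omega> X) =
          (- 1) powi so_epsilon t n lam (partition_rank rho) * of_int (sign \<sigma>) *
          (\<Prod>i = 0..(t - 2) div 2.
             schur (mu3 t n lam i) (map (\<lambda>x. x ^ t) X @ map (\<lambda>x. inverse x ^ t) X)) *
          (if odd t
           then so_char (\<lambda>j. int (part (t_quotient t lam (t * n) ((t - 1) div 2)) j))
                  (map (\<lambda>x. x ^ t) X)
           else 1))"
proof -
  interpret twisted_variables t n \<omega> X
    by unfold_locales (use assms in auto)
  let ?N = "n_residue t lam (t * n)"
  note sc_iff = core_self_conjugate_iff[OF assms(9,7,8,1)]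
  show ?thesis
  proof (intro conjI impI)
    assume "\<not> self_conjugate rho"
    then have "ldet entry rows (beta lam (t * n)) = 0"
      unfolding sc_iff using ldet_entry_nonzero_balanced[of lam] by blast
    then show "so_char (\<lambda>j. int (part lam j)) (twisted t \<omega> X) = 0"
      by (simp add: so_char_def so_alternant_twisted)
  next
    assume sc: "self_conjugate rho"
    let ?r = "partition_rank rho" and ?a = "\<lambda>q. ?N (t - 1 - q)"
    have bal: "balanced lam"
      using sc assms(7,8) unfolding sc_iff balanced_def by blast
    have reindex: "(\<Sum>i = (t + 1) div 2..t - 1. f i) = (\<Sum>q<t div 2. f (t - 1 - q))" for f :: "nat \<Rightarrow> 'b::comm_monoid_add"
      by (rule sum.reindex_bij_witness[of _ "\<lambda>q. t - 1 - q" "\<lambda>i. t - 1 - i"]) (use assms(1) in auto)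
    have "even (?r + (\<Sum>q<t div 2. ?a q + n))"
      using core_rank_parity[OF assms(9,7,8,1) sc] unfolding reindex .
    note parity = sign_parity[of t ?r ?a n, OF this]
    \<comment> \<open>All swaps and block signs except \<open>sign \<sigma>\<close>.\<close>
    let ?E = "fold_swaps lam + ((t choose 2) * (Suc n choose 2) + fold_swaps []) + (\<Sum>q<t div 2. ?a q + n)"
    have fold_Nil: "fold_swaps [] = (\<Sum>q<t div 2. (n choose 2) + n * (n * (t - 2 - 2 * q)))"
      unfolding fold_swaps_def by (rule sum.cong) (use n_residue_Nil in auto)
    have eps: "so_epsilon t n lam ?r = - int (\<Sum>q<t div 2. Suc (?a q) choose 2) + int (if odd t then n * ?r else 0)"
      unfolding so_epsilon_def reindex by simp
    have "even (?E + ((\<Sum>q<t div 2. Suc (?a q) choose 2) + (if odd t then n * ?r else 0)))"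
      using parity unfolding fold_Nil fold_swaps_def[of lam] .
    then have "even (int ?E - so_epsilon t n lam ?r)"
      unfolding eps by (simp only: even_add even_diff even_minus even_of_nat)
    \<comment> \<open>\<open>so_epsilon\<close> may be negative, so the natural exponent
      \<open>?E\<close> is compared with it through \<open>powi\<close>; an even difference is
      enough.\<close>
    then obtain k where "int ?E - so_epsilon t n lam ?r = 2 * k" by (rule evenE)
    then have k: "int ?E = so_epsilon t n lam ?r + (k + k)" by linarith
    have "(- 1) ^ ?E = ((- 1) powi int ?E :: 'a)" by (simp only: power_int_of_nat)
    also have "\<dots> = (- 1) powi so_epsilon t n lam ?r"
      unfolding k by (simp add: power_int_add)
    finally have sign: "(- 1) ^ ?E = ((- 1) powi so_epsilon t n lam ?r :: 'a)" .
    show "so_char (\<lambda>j. int (part lam j)) (twisted t \<omega> X) =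
          (- 1) powi so_epsilon t n lam (partition_rank rho) * of_int (sign \<sigma>) *
          (\<Prod>i = 0..(t - 2) div 2.
             schur (mu3 t n lam i) (map (\<lambda>x. x ^ t) X @ map (\<lambda>x. inverse x ^ t) X)) *
          (if odd t
           then so_char (\<lambda>j. int (part (t_quotient t lam (t * n) ((t - 1) div 2)) j))
                  (map (\<lambda>x. x ^ t) X)
           else 1)"
      unfolding so_char_twisted_eq[OF bal assms(10)] block_factor_quotient sign[symmetric] power_add
      by (simp only: mult_ac)
  qed
qed

end
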